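(* Consider LPC-SVRG (defined in the context) and assume $P$ attains its minimum at $x^*$. Let $T=Sm$, $\eta=\rho/L$ with $0<\rho<\tfrac12$, and let $d_\lambda\ge0$ be a number such that almost surely, at every iteration and for every worker $i$, the number of coordinates of $u_t^i$ lying outside $[-2^{b-1}\delta,(2^{b-1}-1)\delta]$ (with $\delta$ the scale factor used to quantize $u_t^i$) is at most $d_\lambda$. If communication scheme (a) or (b) is used and $$8m^2\rho^2\Big[\frac{d\lambda^2}{4(2^{b-1}-1)^2}+d_\lambda(1-\lambda)^2+\frac{1}{NB}\Big]+\rho\le 1,$$ or if communication scheme (c) is used and $$8m^2\rho^2\Big[\frac{3d\lambda^2}{8(2^{b-1}-1)^2}+d_\lambda(1-\lambda)^2+\frac{1}{NB}\Big]+\rho\le 1,$$ then the output satisfies $$\mathbf{E}\|G_\eta(x_{out})\|^2\le\frac{2L\,(P(x^0)-P(x^* ))}{\rho(1-2\rho)T}.$$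
   Context: Problem setting: $f_1,\dots,f_n:\mathbb{R}^d\to\mathbb{R}$ are differentiable (not necessarily convex) with $\|\nabla f_i(x)-\nabla f_i(y)\|\le L\|x-y\|$; $f=\frac1n\sum_i f_i$; $h:\mathbb{R}^d\to\mathbb{R}\cup\{+\infty\}$ is proper, convex and lower semicontinuous; $P=f+h$; $\mathrm{prox}_{\eta h}(x)=\arg\min_y\{h(y)+\frac{1}{2\eta}\|y-x\|^2\}$. The gradient mapping is $G_\eta(x)=\frac1\eta[x-\mathrm{prox}_{\eta h}(x-\eta\nabla f(x))]$. Quantization: for an integer $b\ge2$ and $\delta>0$, $\mathrm{dom}(\delta,b)=\{k\delta:k\in\mathbb{Z},-2^{b-1}\le k\le 2^{b-1}-1\}$; the scalar quantizer $Q_{(\delta,b)}(x)$, for $x\in[-2^{b-1}\delta,(2^{b-1}-1)\delta]$ with $z$ the largest grid point $\le x$, equals $z$ with probability $\frac{z+\delta-x}{\delta}$ and $z+\delta$ otherwise; for $x$ outside this interval it equals the nearest grid point. On vectors it acts coordinatewise with independent randomness. If $\delta=0$ (only when the vector to be quantized is $0$) the output is $0$. LPC-SVRG with $N$ workers, parameters $S,m,B\in\mathbb{N}$, $\eta>0$, $\lambda\in(0,1]$, $b\ge 2$, starting point $\tilde x^0=x^0$: for $s=0,\dots,S-1$, set $x_0^{s+1}=\tilde x^s$ and compute $\nabla f(\tilde x^s)$ exactly; for $t=0,\dots,m-1$: each worker $i$ draws $B$ indices independently and uniformly from $\{1,\dots,n\}$ (with replacement; independent across workers and iterations), forming $I_t^i$,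 and computes $u_t^i=\frac1B\sum_{a\in I_t^i}[\nabla f_a(x_t^{s+1})-\nabla f_a(\tilde x^s)]$; let $\delta_t^i=\frac{\lambda\|u_t^i\|_\infty}{2^{b-1}-1}$. Then $\tilde u_t$ is formed by one of: (a) $\tilde u_t=\frac1N\sum_i Q_{(\delta_t^i,b)}(u_t^i)$; (b) with $\delta_t=\max_i\delta_t^i$, $\tilde u_t=\frac1N\sum_i Q_{(\delta_t,b)}(u_t^i)$; (c) with $\delta_t=\max_i\delta_t^i$ and $\tilde u_t^i=Q_{(\delta_t,b)}(u_t^i)$, $\tilde u_t=Q_{(\delta_t,b)}(\frac1N\sum_i\tilde u_t^i)$ (fresh independent rounding). All roundings are independent given the sampled indices. Then $v_t^{s+1}=\tilde u_t+\nabla f(\tilde x^s)$, $x_{t+1}^{s+1}=\mathrm{prox}_{\eta h}(x_t^{s+1}-\eta v_t^{s+1})$; after the inner loop $\tilde x^{s+1}=x_m^{s+1}$. The output $x_{out}$ is chosen uniformly at random from $\{x_t^{s+1}:0\le t\le m-1,\ 0\le s\le S-1\}$. *)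

theory Defs
  imports "HOL-Analysis.Analysis" "HOL-Probability.Probability"
begin

definition proper_fun :: "('a \<Rightarrow> ereal) \<Rightarrow> bool" where
  "proper_fun h \<longleftrightarrow> (\<forall>x. h x \<noteq> -\<infinity>) \<and> (\<exists>x. h x \<noteq> \<infinity>)"

definition convex_ext :: "('a::real_vector \<Rightarrow> ereal) \<Rightarrow> bool" where
  "convex_ext h \<longleftrightarrow> (\<forall>x y u. 0 \<le> u \<and> u \<le> 1 \<longrightarrow>
      h ((1 - u) *\<^sub>R x + u *\<^sub>R y) \<le> ereal (1 - u) * h x + ereal u * h y)"

definition lsc_fun :: "('a::topological_space \<Rightarrow> ereal) \<Rightarrow> bool" where
  "lsc_fun h \<longleftrightarrow> (\<forall>x c. c < h x \<longrightarrow> eventually (\<lambda>y. c < h y) (at x))"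

definition prox :: "real \<Rightarrow> ('a::real_normed_vector \<Rightarrow> ereal) \<Rightarrow> 'a \<Rightarrow> 'a" where
  "prox \<eta> h x = (SOME y. \<forall>z. h y + ereal ((norm (y - x))\<^sup>2 / (2 * \<eta>))
                              \<le> h z + ereal ((norm (z - x))\<^sup>2 / (2 * \<eta>)))"

definition grad_map :: "real \<Rightarrow> ('a::real_normed_vector \<Rightarrow> ereal) \<Rightarrow> ('a \<Rightarrow> 'a) \<Rightarrow> 'a \<Rightarrow> 'a" where
  "grad_map \<eta> h gradf x = (1 / \<eta>) *\<^sub>R (x - prox \<eta> h (x - \<eta> *\<^sub>R gradf x))"

definition qscalar :: "real \<Rightarrow> nat \<Rightarrow> real \<Rightarrow> real pmf" where
  "qscalar \<delta> b x =
     (if \<delta> = 0 then return_pmf 0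
      else if x < - (2 ^ (b - 1)) * \<delta> then return_pmf (- (2 ^ (b - 1)) * \<delta>)
      else if x > (2 ^ (b - 1) - 1) * \<delta> then return_pmf ((2 ^ (b - 1) - 1) * \<delta>)
      else (let z = of_int \<lfloor>x / \<delta>\<rfloor> * \<delta> in
            map_pmf (\<lambda>c. if c then z else z + \<delta>) (bernoulli_pmf ((z + \<delta> - x) / \<delta>))))"

definition qvec :: "real \<Rightarrow> nat \<Rightarrow> real^'d \<Rightarrow> (real^'d) pmf" where
  "qvec \<delta> b v = map_pmf (\<lambda>g. \<chi> j. g j) (Pi_pmf UNIV 0 (\<lambda>j. qscalar \<delta> b (v $ j)))"

definition n_outside :: "nat \<Rightarrow> real \<Rightarrow> real^'d \<Rightarrow> nat" where
  "n_outside b \<delta> u = card {j. u $ j < - (2 ^ (b - 1)) * \<delta> \<or> u $ j > (2 ^ (b - 1) - 1) * \<delta>}"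

datatype scheme = SchemeA | SchemeB | SchemeC

definition mb_u :: "(nat \<Rightarrow> real^'d \<Rightarrow> real^'d) \<Rightarrow> nat \<Rightarrow> real^'d \<Rightarrow> real^'d \<Rightarrow> (nat \<Rightarrow> nat) \<Rightarrow> real^'d" where
  "mb_u gf B xt x I = (1 / real B) *\<^sub>R (\<Sum>a<B. gf (I a) x - gf (I a) xt)"

definition full_grad :: "(nat \<Rightarrow> real^'d \<Rightarrow> real^'d) \<Rightarrow> nat \<Rightarrow> real^'d \<Rightarrow> real^'d" where
  "full_grad gf n x = (1 / real n) *\<^sub>R (\<Sum>i=1..n. gf i x)"

definition lpc_step ::
  "scheme \<Rightarrow> (nat \<Rightarrow> real^'d \<Rightarrow> real^'d) \<Rightarrow> (real^'d \<Rightarrow> ereal) \<Rightarrow> nat \<Rightarrow> nat \<Rightarrow> nat \<Rightarrow> real \<Rightarrow> real \<Rightarrow> nat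
   \<Rightarrow> real^'d \<Rightarrow> real^'d \<Rightarrow> ((real^'d) \<times> ((real^'d) \<times> real) list) pmf" where
  "lpc_step sch gf h n N B \<eta> lam b xt x =
    bind_pmf (Pi_pmf {..<N} (\<lambda>_. 0) (\<lambda>i. Pi_pmf {..<B} 0 (\<lambda>_. pmf_of_set {1..n})))
     (\<lambda>Is. let u = (\<lambda>i. mb_u gf B xt x (Is i));
               di = (\<lambda>i. lam * infnorm (u i) / (2 ^ (b - 1) - 1));
               dmax = Max (di ` {..<N});
               dused = (if sch = SchemeA then di else (\<lambda>_. dmax));
               lg = map (\<lambda>i. (u i, dused i)) [0..<N]
           in bind_pmf (Pi_pmf {..<N} 0 (\<lambda>i. qvec (dused i) b (u i)))
               (\<lambda>q. let avg = (1 / real N) *\<^sub>R (\<Sum>i<N. q i)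
                    in map_pmf (\<lambda>ut. (prox \<eta> h (x - \<eta> *\<^sub>R (ut + full_grad gf n xt)), lg))
                         (if sch = SchemeC then qvec dmax b avg else return_pmf avg)))"

fun lpc_inner ::
  "scheme \<Rightarrow> (nat \<Rightarrow> real^'d \<Rightarrow> real^'d) \<Rightarrow> (real^'d \<Rightarrow> ereal) \<Rightarrow> nat \<Rightarrow> nat \<Rightarrow> nat \<Rightarrow> real \<Rightarrow> real \<Rightarrow> nat
   \<Rightarrow> real^'d \<Rightarrow> nat \<Rightarrow> real^'d \<Rightarrow> ((real^'d) list \<times> ((real^'d) \<times> real) list) pmf" where
  "lpc_inner sch gf h n N B \<eta> lam b xt 0 x = return_pmf ([x], [])"
| "lpc_inner sch gf h n N B \<eta> lam b xt (Suc k) x =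
     bind_pmf (lpc_step sch gf h n N B \<eta> lam b xt x)
       (\<lambda>(x', lg). map_pmf (\<lambda>(xs, lgs). (x # xs, lg @ lgs))
                      (lpc_inner sch gf h n N B \<eta> lam b xt k x'))"

text \<open>s outer epochs of m inner iterations each, started at snapshot xt: returns the list of
  inner iterates x_t^{s+1} (t < m) of all epochs in order, and all logs.\<close>
fun lpc_outer ::
  "scheme \<Rightarrow> (nat \<Rightarrow> real^'d \<Rightarrow> real^'d) \<Rightarrow> (real^'d \<Rightarrow> ereal) \<Rightarrow> nat \<Rightarrow> nat \<Rightarrow> nat \<Rightarrow> real \<Rightarrow> real \<Rightarrow> nat
   \<Rightarrow> nat \<Rightarrow> nat \<Rightarrow> real^'d \<Rightarrow> ((real^'d) list \<times> ((real^'d) \<times> real) list) pmf" where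
  "lpc_outer sch gf h n N B \<eta> lam b m 0 xt = return_pmf ([], [])"
| "lpc_outer sch gf h n N B \<eta> lam b m (Suc s) xt =
     bind_pmf (lpc_inner sch gf h n N B \<eta> lam b xt m xt)
       (\<lambda>(xs, lg). map_pmf (\<lambda>(ys, lgs). (take m xs @ ys, lg @ lgs))
                      (lpc_outer sch gf h n N B \<eta> lam b m s (last xs)))"

definition lpc_output ::
  "scheme \<Rightarrow> (nat \<Rightarrow> real^'d \<Rightarrow> real^'d) \<Rightarrow> (real^'d \<Rightarrow> ereal) \<Rightarrow> nat \<Rightarrow> nat \<Rightarrow> nat \<Rightarrow> real \<Rightarrow> real \<Rightarrow> nat
   \<Rightarrow> nat \<Rightarrow> nat \<Rightarrow> real^'d \<Rightarrow> (real^'d) pmf" where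
  "lpc_output sch gf h n N B \<eta> lam b m S x0 =
     bind_pmf (lpc_outer sch gf h n N B \<eta> lam b m S x0)
       (\<lambda>(xs, _). map_pmf (\<lambda>j. xs ! j) (pmf_of_set {..<length xs}))"

end

theory Submission
  imports Defs
begin

text \<open>
  Write \<open>x\<^sup>+\<close> for the iterate after \<open>x\<close>, \<open>v\<close> for the gradient estimate used there and \<open>y\<close> for the
  snapshot of the current epoch. Comparing \<open>x\<^sup>+\<close> with the exact proximal gradient step and using the
  three-point inequality of the proximal operator twice gives
  \<open>P x\<^sup>+ + \<alpha> \<parallel>G x\<parallel>\<^sup>2 + \<beta> \<parallel>x\<^sup>+ - x\<parallel>\<^sup>2 \<le> P x + \<eta> / 2 * \<parallel>v - \<nabla>f x\<parallel>\<^sup>2\<close>.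
  All stochastic differences have norm at most \<open>L \<parallel>x - y\<parallel>\<close>, so the rounding error is at most the grid
  width in each unclipped coordinate and at most \<open>(1 - \<lambda>) L \<parallel>x - y\<parallel>\<close> in each clipped one, while
  independence bounds the sampling variance by \<open>L\<^sup>2 \<parallel>x - y\<parallel>\<^sup>2 / (N B)\<close>. Hence the expected gradient error
  is at most a constant times \<open>L\<^sup>2 \<parallel>x - y\<parallel>\<^sup>2\<close>. Within an epoch of length \<open>m\<close> the sum of the \<open>\<parallel>x - y\<parallel>\<^sup>2\<close>
  is at most \<open>m\<^sup>2 / 2\<close> times the sum of the \<open>\<parallel>x\<^sup>+ - x\<parallel>\<^sup>2\<close>, so under the step size condition the \<open>\<beta>\<close>
  terms absorb the error, and the sum over all epochs telescopes.
\<close>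

section \<open>Inexact proximal gradient steps\<close>

lemma smooth_upper_bound:
  fixes F :: "'a::euclidean_space \<Rightarrow> real"
  assumes deriv: "\<And>x. (F has_derivative (\<lambda>v. G x \<bullet> v)) (at x)"
    and lip: "\<And>x y. norm (G x - G y) \<le> L * norm (x - y)"
  shows "F y \<le> F x + G x \<bullet> (y - x) + L / 2 * (norm (y - x))\<^sup>2"
proof -
  define v where "v = y - x"
  define \<phi> where "\<phi> t = F (x + t *\<^sub>R v) - t * (G x \<bullet> v) - L * t\<^sup>2 / 2 * (norm v)\<^sup>2" for t
  have D: "(\<phi> has_real_derivative (G (x + t *\<^sub>R v) \<bullet> v - G x \<bullet> v - L * t * (norm v)\<^sup>2)) (at t)" for t
  proof -
    have "((\<lambda>t. x + t *\<^sub>R v) has_derivative (\<lambda>s. s *\<^sub>R v)) (at t)"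
      by (auto intro!: derivative_eq_intros)
    from diff_chain_at[OF this deriv, unfolded o_def]
    have "((\<lambda>t. F (x + t *\<^sub>R v)) has_real_derivative (G (x + t *\<^sub>R v) \<bullet> v)) (at t)"
      by (rule has_derivative_imp_has_field_derivative) simp
    then show ?thesis unfolding \<phi>_def
      by (auto intro!: derivative_eq_intros)
  qed
  have "\<phi> 1 \<le> \<phi> 0"
  proof (rule DERIV_nonpos_imp_nonincreasing[of 0 1 \<phi>])
    fix t :: real assume t: "0 \<le> t" "t \<le> 1"
    have "G (x + t *\<^sub>R v) \<bullet> v - G x \<bullet> v \<le> norm (G (x + t *\<^sub>R v) - G x) * norm v"
      unfolding inner_diff_left[symmetric] by (rule norm_cauchy_schwarz)
    also have "\<dots> \<le> (L * norm (t *\<^sub>R v)) * norm v"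
      using lip[of "x + t *\<^sub>R v" x] by (intro mult_right_mono) auto
    also have "\<dots> = L * t * (norm v)\<^sup>2" using t by (simp add: power2_eq_square)
    finally have "G (x + t *\<^sub>R v) \<bullet> v - G x \<bullet> v - L * t * (norm v)\<^sup>2 \<le> 0" by simp
    with D show "\<exists>y. DERIV \<phi> t :> y \<and> y \<le> 0" by blast
  qed simp
  then show ?thesis by (simp add: \<phi>_def v_def)
qed

lemma smooth_lower_bound:
  fixes F :: "'a::euclidean_space \<Rightarrow> real"
  assumes deriv: "\<And>x. (F has_derivative (\<lambda>v. G x \<bullet> v)) (at x)"
    and lip: "\<And>x y. norm (G x - G y) \<le> L * norm (x - y)"
  shows "F y \<ge> F x + G x \<bullet> (y - x) - L / 2 * (norm (y - x))\<^sup>2"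
proof -
  have "- F y \<le> - F x + (- G x) \<bullet> (y - x) + L / 2 * (norm (y - x))\<^sup>2"
  proof (rule smooth_upper_bound)
    show "((\<lambda>x. - F x) has_derivative (\<lambda>v. - G x \<bullet> v)) (at x)" for x
      using has_derivative_minus[OF deriv] by simp
    show "norm (- G x - - G y) \<le> L * norm (x - y)" for x y
      using lip[of y x] by (simp add: norm_minus_commute)
  qed
  then show ?thesis by simp
qed

section \<open>Lower semicontinuous functions and their minima on compact sets\<close>

lemma lsc_fun_add_continuous:
  fixes h :: "'a::topological_space \<Rightarrow> ereal" and q :: "'a \<Rightarrow> real"
  assumes lsc: "lsc_fun h" and ninf: "\<And>x. h x \<noteq> -\<infinity>" and q: "continuous_on UNIV q"
  shows "lsc_fun (\<lambda>x. h x + ereal (q x))"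
  unfolding lsc_fun_def
proof (intro allI impI)
  fix x c assume c: "c < h x + ereal (q x)"
  show "eventually (\<lambda>y. c < h y + ereal (q y)) (at x)"
  proof (cases c)
    case (real r)
    have "ereal (r - q x) < h x" using c real by (cases "h x") auto
    \<comment> \<open>The slack is shared at the level \<open>e\<close> strictly between
      \<open>r - q x\<close> and \<open>h x\<close>: near x both \<open>h y > e\<close> and
      \<open>q y > r - e\<close> hold, and these add up to a value above \<open>r\<close>.\<close>
    then obtain e where e: "ereal (r - q x) < ereal e" "ereal e < h x"
      using ereal_dense2 by blast
    have "eventually (\<lambda>y. ereal e < h y) (at x)" using lsc e unfolding lsc_fun_def by blast
    moreover have "(q \<longlongrightarrow> q x) (at x)"
      using q by (simp add: continuous_on_def)
    then have "eventually (\<lambda>y. r - e < q y) (at x)"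
      using e by (intro order_tendstoD(1)) auto
    ultimately show ?thesis
    proof eventually_elim
      case (elim y)
      then show ?case using real by (cases "h y") auto
    qed
  next
    case PInf then show ?thesis using c by simp
  next
    case MInf
    have "-\<infinity> < h y + ereal (q y)" for y using ninf[of y] by (cases "h y") auto
    then show ?thesis using MInf by simp
  qed
qed

text \<open>Without a minimizer the open sets \<open>{y. g z < g y}\<close> with z in K cover K. In
  a finite subcover indexed by T, the point of T with least value would have to be covered by a
  point of T with a smaller value.\<close>

lemma lsc_fun_attains_min:
  assumes lsc: "lsc_fun g" and K: "compact K" "K \<noteq> {}"
  shows "\<exists>y\<in>K. \<forall>z\<in>K. g y \<le> g z"
proof (rule ccontr)
  assume "\<not> ?thesis"
  then have ex: "\<forall>y\<in>K. \<exists>z\<in>K. g z < g y" by (meson not_le)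
  \<comment> \<open>\<open>lsc_fun\<close> speaks of punctured neighbourhoods; at the centre itself
    the inequality is the membership assumption.\<close>
  have op: "open {y. c < g y}" for c
  proof (subst open_subopen, intro ballI)
    fix x assume "x \<in> {y. c < g y}"
    then have "eventually (\<lambda>y. c < g y) (nhds x)"
      using lsc unfolding lsc_fun_def eventually_nhds_conv_at by simp
    then show "\<exists>T. open T \<and> x \<in> T \<and> T \<subseteq> {y. c < g y}"
      unfolding eventually_nhds by auto
  qed
  have "K \<subseteq> (\<Union>z\<in>K. {y. g z < g y})" using ex by auto
  then obtain T where T: "T \<subseteq> K" "finite T" "K \<subseteq> (\<Union>z\<in>T. {y. g z < g y})"
    using compactE_image[OF K(1), of K "\<lambda>z. {y. g z < g y}"] op by blast
  have "T \<noteq> {}" using T K by auto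
  then have "Min (g ` T) \<in> g ` T" using T(2) by (intro Min_in) auto
  then obtain w where w: "w \<in> T" "g w = Min (g ` T)" by auto
  obtain z where "z \<in> T" "g z < g w" using T w(1) by blast
  moreover have "g w \<le> g z" using w(2) T(2) \<open>z \<in> T\<close> by simp
  ultimately show False by simp
qed

section \<open>Proximal gradient steps for a smooth function plus a convex one\<close>

locale composite =
  fixes F :: "'a::euclidean_space \<Rightarrow> real" and G :: "'a \<Rightarrow> 'a" and h :: "'a \<Rightarrow> ereal"
    and L \<eta> :: real and xstar :: 'a
  assumes L_pos: "L > 0" and eta_pos: "\<eta> > 0" and eta_L: "\<eta> * L < 1"
    and F_deriv: "\<And>x. (F has_derivative (\<lambda>v. G x \<bullet> v)) (at x)"
    and G_lip: "\<And>x y. norm (G x - G y) \<le> L * norm (x - y)"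
    and h_proper: "proper_fun h" and h_convex: "convex_ext h" and h_lsc: "lsc_fun h"
    and xstar_min: "\<And>x. ereal (F xstar) + h xstar \<le> ereal (F x) + h x"
begin

lemma h_not_MInf [simp]: "h x \<noteq> -\<infinity>"
  using h_proper by (simp add: proper_fun_def)

lemma h_xstar: "h xstar \<noteq> \<infinity>"
proof -
  obtain x where "h x \<noteq> \<infinity>" using h_proper by (auto simp: proper_fun_def)
  then show ?thesis using xstar_min[of x] by auto
qed

text \<open>Real-valued version of \<open>h\<close>, with value 0 where \<open>h\<close> is
  infinite. Hence \<open>P\<close> is the true objective only where \<open>h\<close> is finite,
  which explains the side conditions \<open>h x \<noteq> \<infinity>\<close> below.\<close>

definition hr :: "'a \<Rightarrow> real" where "hr x = real_of_ereal (h x)"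

definition P :: "'a \<Rightarrow> real" where "P x = F x + hr x"

lemma ereal_hr: "h x \<noteq> \<infinity> \<Longrightarrow> h x = ereal (hr x)"
  using h_not_MInf[of x] by (cases "h x") (auto simp: hr_def)

lemma P_ge: "h x \<noteq> \<infinity> \<Longrightarrow> P xstar \<le> P x"
  using xstar_min[of x] ereal_hr[of x] ereal_hr[OF h_xstar] by (simp add: P_def)

text \<open>Since \<open>F + h\<close> is bounded below and \<open>F\<close> grows at most like \<open>L / 2 * \<parallel>z\<parallel>\<^sup>2\<close>, the proximal
  objective is coercive as soon as \<open>\<eta> * L < 1\<close>.\<close>

lemma prox_minimizer_exists:
  "\<exists>y. \<forall>z. h y + ereal ((norm (y - w))\<^sup>2 / (2 * \<eta>)) \<le> h z + ereal ((norm (z - w))\<^sup>2 / (2 * \<eta>))"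
proof -
  define g where "g z = h z + ereal ((norm (z - w))\<^sup>2 / (2 * \<eta>))" for z
  define M where "M = hr xstar + (norm (xstar - w))\<^sup>2 / (2 * \<eta>)"
  have gM: "g xstar = ereal M" using ereal_hr[OF h_xstar] by (simp add: g_def M_def)
  define c where "c = P xstar - F w"
  define a where "a = norm (G w)"
  define k where "k = 1 / (2 * \<eta>) - L / 2"
  have k: "k > 0" using eta_pos eta_L by (simp add: k_def field_simps)
  have low: "ereal (c - a * norm (z - w) + k * (norm (z - w))\<^sup>2) \<le> g z" for z
  proof (cases "h z = \<infinity>")
    case False
    have "F z \<le> F w + G w \<bullet> (z - w) + L / 2 * (norm (z - w))\<^sup>2"
      by (rule smooth_upper_bound[OF F_deriv G_lip])
    moreover have "G w \<bullet> (z - w) \<le> a * norm (z - w)"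
      unfolding a_def by (rule norm_cauchy_schwarz)
    moreover have "P xstar \<le> F z + hr z" using P_ge[OF False] by (simp add: P_def)
    ultimately have "c - a * norm (z - w) + k * (norm (z - w))\<^sup>2 \<le> hr z + (norm (z - w))\<^sup>2 / (2 * \<eta>)"
      by (simp add: c_def k_def algebra_simps)
    then show ?thesis using ereal_hr[OF False] by (simp add: g_def)
  qed (simp add: g_def)
  \<comment> \<open>With r = norm (z - w) > R, both r \<ge> 1 and k r - a \<ge> |M - c| + 1 hold, so
    the lower bound c + r (k r - a) exceeds M, the value at \<open>xstar\<close>. A minimizer over
    the ball of radius R is therefore a global one.\<close>
  define R where "R = 1 + (a + \<bar>M - c\<bar> + 1) / k"
  have R0: "R \<ge> 1" using k by (simp add: R_def a_def)
  have out: "ereal M < g z" if "norm (z - w) > R" for z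
  proof -
    define r where "r = norm (z - w)"
    have r1: "r \<ge> 1" using that R0 by (simp add: r_def)
    have "r > (a + \<bar>M - c\<bar> + 1) / k" using that R_def r_def by linarith
    then have "k * r - a \<ge> \<bar>M - c\<bar> + 1" using k by (simp add: field_simps)
    then have "1 * (\<bar>M - c\<bar> + 1) \<le> r * (k * r - a)" using r1 by (intro mult_mono) auto
    then have "M < c - a * r + k * r\<^sup>2" by (simp add: algebra_simps power2_eq_square)
    then show ?thesis using low[of z] unfolding r_def
      by (meson ereal_less_eq(3) less_ereal.simps(1) less_le_trans)
  qed
  have "lsc_fun g" unfolding g_def
    by (intro lsc_fun_add_continuous h_lsc h_not_MInf continuous_intros) (use eta_pos in auto)
  then obtain y where y: "y \<in> cball w R" "\<forall>z\<in>cball w R. g y \<le> g z"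
    using lsc_fun_attains_min[of g "cball w R"] R0 by auto
  have xs: "xstar \<in> cball w R"
    using out[of xstar] gM by (force simp: dist_norm norm_minus_commute)
  have "g y \<le> g z" for z
  proof (cases "z \<in> cball w R")
    case False
    then have "ereal M < g z" by (intro out) (simp add: dist_norm norm_minus_commute)
    then show ?thesis using y xs gM by (metis le_less_trans less_imp_le)
  qed (use y in auto)
  then show ?thesis unfolding g_def by blast
qed

lemma prox_min:
  "h (prox \<eta> h w) + ereal ((norm (prox \<eta> h w - w))\<^sup>2 / (2 * \<eta>))
     \<le> h z + ereal ((norm (z - w))\<^sup>2 / (2 * \<eta>))"
  using someI_ex[OF prox_minimizer_exists[of w]] unfolding prox_def by blast

lemma h_prox: "h (prox \<eta> h w) \<noteq> \<infinity>"
  using prox_min[of w xstar] h_xstar by (cases "h xstar") auto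

text \<open>The extra term in z - y comes from strong convexity of the proximal objective: comparing
  the minimizer y with (1 - u) y + u z and dividing by u yields \<open>(1 - u) * C \<le> A\<close>,
  and u tends to 0 from the right.\<close>

lemma prox_three_point:
  fixes w z :: 'a
  assumes "h z \<noteq> \<infinity>"
  defines "y \<equiv> prox \<eta> h w"
  shows "hr y + (norm (y - w))\<^sup>2 / (2 * \<eta>) + (norm (z - y))\<^sup>2 / (2 * \<eta>)
           \<le> hr z + (norm (z - w))\<^sup>2 / (2 * \<eta>)"
proof -
  have hy: "h y = ereal (hr y)" unfolding y_def by (intro ereal_hr h_prox)
  have hz: "h z = ereal (hr z)" by (intro ereal_hr assms)
  define Y where "Y = (norm (y - w))\<^sup>2 / (2 * \<eta>)"
  define Z where "Z = (norm (z - w))\<^sup>2 / (2 * \<eta>)"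
  define A where "A = hr z + (norm (z - w))\<^sup>2 / (2 * \<eta>) - (hr y + (norm (y - w))\<^sup>2 / (2 * \<eta>))"
  define C where "C = (norm (z - y))\<^sup>2 / (2 * \<eta>)"
  have ineq: "(1 - u) * C \<le> A" if u: "0 < u" "u < 1" for u
  proof -
    define p where "p = (1 - u) *\<^sub>R y + u *\<^sub>R z"
    have hp: "h p \<le> ereal ((1 - u) * hr y + u * hr z)"
    proof -
      have "h p \<le> ereal (1 - u) * h y + ereal u * h z"
        using h_convex u unfolding convex_ext_def p_def by simp
      then show ?thesis by (simp add: hy hz)
    qed
    have "ereal (hr y + (norm (y - w))\<^sup>2 / (2 * \<eta>)) \<le> h p + ereal ((norm (p - w))\<^sup>2 / (2 * \<eta>))"
      using prox_min[of w p] hy by (simp add: y_def)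
    also have "\<dots> \<le> ereal ((1 - u) * hr y + u * hr z) + ereal ((norm (p - w))\<^sup>2 / (2 * \<eta>))"
      by (intro add_right_mono hp)
    finally have 1: "hr y + (norm (y - w))\<^sup>2 / (2 * \<eta>)
        \<le> (1 - u) * hr y + u * hr z + (norm (p - w))\<^sup>2 / (2 * \<eta>)" by simp
    have 2: "(norm (p - w))\<^sup>2 = (1 - u) * (norm (y - w))\<^sup>2 + u * (norm (z - w))\<^sup>2
        - u * (1 - u) * (norm (z - y))\<^sup>2"
      unfolding p_def power2_norm_eq_inner
      by (simp add: inner_simps inner_commute algebra_simps power2_eq_square)
    have 3: "(norm (p - w))\<^sup>2 / (2 * \<eta>) = (1 - u) * ((norm (y - w))\<^sup>2 / (2 * \<eta>))
        + u * ((norm (z - w))\<^sup>2 / (2 * \<eta>)) - u * (1 - u) * C"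
      by (simp add: 2 C_def add_divide_distrib diff_divide_distrib)
    have "u * ((1 - u) * C) \<le> u * A"
      using 1 unfolding 3 A_def Y_def[symmetric] Z_def[symmetric] by (simp add: algebra_simps)
    then show ?thesis using u by simp
  qed
  have "((\<lambda>u. (1 - u) * C) \<longlongrightarrow> (1 - 0) * C) (at_right 0)"
    by (intro tendsto_intros)
  moreover have "eventually (\<lambda>u. (1 - u) * C \<le> A) (at_right 0)"
    using eventually_at_right_real[OF zero_less_one] by eventually_elim (auto intro: ineq)
  ultimately have "(1 - 0) * C \<le> A"
    by (intro tendsto_upperbound) auto
  then show ?thesis by (simp add: A_def C_def)
qed

text \<open>Expanding the squares around x - \<eta> v turns the three-point inequality into one with
  a linear term in v. Adding the smooth upper bound at y and the smooth lower bound at z leaves the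
  linear terms as (y - z) \<bullet> (G x - v). As F need not be convex, the lower bound costs L / 2
  in the coefficient at z - x.\<close>

lemma prox_grad_descent:
  fixes x v z :: 'a
  assumes hz: "h z \<noteq> \<infinity>"
  defines "y \<equiv> prox \<eta> h (x - \<eta> *\<^sub>R v)"
  shows "P y \<le> P z + (y - z) \<bullet> (G x - v) + (L / 2 - 1 / (2 * \<eta>)) * (norm (y - x))\<^sup>2
      + (L / 2 + 1 / (2 * \<eta>)) * (norm (z - x))\<^sup>2 - 1 / (2 * \<eta>) * (norm (y - z))\<^sup>2"
proof -
  have e: "(norm (p - (x - \<eta> *\<^sub>R v)))\<^sup>2 / (2 * \<eta>)
      = (norm (p - x))\<^sup>2 / (2 * \<eta>) + (p - x) \<bullet> v + \<eta> / 2 * (norm v)\<^sup>2" for p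
    unfolding power2_norm_eq_inner using eta_pos
    by (simp add: inner_simps inner_commute field_simps)
  have 1: "hr y + (norm (y - x))\<^sup>2 / (2 * \<eta>) + (y - x) \<bullet> v + (norm (z - y))\<^sup>2 / (2 * \<eta>)
      \<le> hr z + (norm (z - x))\<^sup>2 / (2 * \<eta>) + (z - x) \<bullet> v"
    using prox_three_point[OF hz, of "x - \<eta> *\<^sub>R v"] unfolding y_def[symmetric] e by simp
  have 2: "F y \<le> F x + G x \<bullet> (y - x) + L / 2 * (norm (y - x))\<^sup>2"
    by (rule smooth_upper_bound[OF F_deriv G_lip])
  have 3: "F z \<ge> F x + G x \<bullet> (z - x) - L / 2 * (norm (z - x))\<^sup>2"
    by (rule smooth_lower_bound[OF F_deriv G_lip])
  show ?thesis using 1 2 3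
    by (simp add: P_def inner_simps inner_commute algebra_simps norm_minus_commute)
qed

text \<open>Descent is applied twice, from x to the exact proximal point \<open>xb\<close> and from
  \<open>xb\<close> to y. Young's inequality splits the product of y - xb with the gradient error,
  weighted so that its part in y - xb cancels the last term of the second descent.\<close>

lemma inexact_prox_step:
  fixes x v :: 'a
  assumes hx: "h x \<noteq> \<infinity>"
  defines "y \<equiv> prox \<eta> h (x - \<eta> *\<^sub>R v)"
  shows "P y + \<eta> / 2 * (1 - 2 * (\<eta> * L)) * (norm (grad_map \<eta> h G x))\<^sup>2
      + (1 / (2 * \<eta>) - L / 2) * (norm (y - x))\<^sup>2 \<le> P x + \<eta> / 2 * (norm (v - G x))\<^sup>2"
proof -
  define xb where "xb = prox \<eta> h (x - \<eta> *\<^sub>R G x)"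
  have "P xb \<le> P x + (xb - x) \<bullet> (G x - G x) + (L / 2 - 1 / (2 * \<eta>)) * (norm (xb - x))\<^sup>2
      + (L / 2 + 1 / (2 * \<eta>)) * (norm (x - x))\<^sup>2 - 1 / (2 * \<eta>) * (norm (xb - x))\<^sup>2"
    unfolding xb_def by (rule prox_grad_descent[OF hx])
  moreover have "P y \<le> P xb + (y - xb) \<bullet> (G x - v) + (L / 2 - 1 / (2 * \<eta>)) * (norm (y - x))\<^sup>2
      + (L / 2 + 1 / (2 * \<eta>)) * (norm (xb - x))\<^sup>2 - 1 / (2 * \<eta>) * (norm (y - xb))\<^sup>2"
    unfolding y_def by (rule prox_grad_descent) (simp add: xb_def h_prox)
  moreover have "(y - xb) \<bullet> (G x - v) \<le> 1 / (2 * \<eta>) * (norm (y - xb))\<^sup>2 + \<eta> / 2 * (norm (v - G x))\<^sup>2"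
  proof -
    have sq: "(norm (a - \<eta> *\<^sub>R c))\<^sup>2 / (2 * \<eta>)
        = 1 / (2 * \<eta>) * (norm a)\<^sup>2 + \<eta> / 2 * (norm c)\<^sup>2 - a \<bullet> c" for a c :: 'a
      unfolding power2_norm_eq_inner using eta_pos
      by (simp add: inner_diff_left inner_diff_right inner_commute field_simps)
    have "0 \<le> (norm ((y - xb) - \<eta> *\<^sub>R (G x - v)))\<^sup>2 / (2 * \<eta>)" using eta_pos by simp
    also have "\<dots> = 1 / (2 * \<eta>) * (norm (y - xb))\<^sup>2 + \<eta> / 2 * (norm (G x - v))\<^sup>2 - (y - xb) \<bullet> (G x - v)"
      by (rule sq)
    finally show ?thesis by (simp add: norm_minus_commute)
  qed
  \<comment> \<open>The coefficients at xb - x add up to (L/2 - 1/(2\<eta>)) - 1/(2\<eta>) + (L/2 +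
    1/(2\<eta>)) = -(1/(2\<eta>) - L), and the gradient mapping is (x - xb) / \<eta>.\<close>
  moreover have "\<eta> / 2 * (1 - 2 * (\<eta> * L)) * (norm (grad_map \<eta> h G x))\<^sup>2
      = (1 / (2 * \<eta>) - L) * (norm (xb - x))\<^sup>2"
  proof -
    have "(norm (grad_map \<eta> h G x))\<^sup>2 = (norm (xb - x))\<^sup>2 / \<eta>\<^sup>2"
      using eta_pos unfolding grad_map_def xb_def[symmetric]
      by (simp add: norm_minus_commute power_divide)
    then have "\<eta> / 2 * (1 - 2 * (\<eta> * L)) * (norm (grad_map \<eta> h G x))\<^sup>2
        = \<eta> / 2 * (1 - 2 * (\<eta> * L)) / \<eta>\<^sup>2 * (norm (xb - x))\<^sup>2" by simp
    also have "\<eta> / 2 * (1 - 2 * (\<eta> * L)) / \<eta>\<^sup>2 = 1 / (2 * \<eta>) - L"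
      using eta_pos by (simp add: field_simps power2_eq_square)
    finally show ?thesis .
  qed
  ultimately show ?thesis by (simp add: algebra_simps)
qed

end

section \<open>Finitely supported expectations\<close>

lemma finite_set_Pi_pmf:
  assumes "finite A" "\<And>i. i \<in> A \<Longrightarrow> finite (set_pmf (p i))"
  shows "finite (set_pmf (Pi_pmf A d p))"
  using assms by (subst set_Pi_pmf) auto

text \<open>Sampled indices and roundings take finitely many values, so all distributions of the
  algorithm have finite support and conditioning on the first stage raises no integrability
  question.\<close>

lemma expectation_bind_finite:
  fixes g :: "'b \<Rightarrow> 'c::{banach, second_countable_topology}"
  assumes "finite (set_pmf p)" "\<And>x. x \<in> set_pmf p \<Longrightarrow> finite (set_pmf (f x))"
  shows "measure_pmf.expectation (bind_pmf p f) g
      = measure_pmf.expectation p (\<lambda>x. measure_pmf.expectation (f x) g)"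
  using assms by (subst pmf_expectation_bind[where A = "set_pmf p"])
    (auto simp: integral_measure_pmf[where A = "set_pmf p"])

lemma expectation_mono_finite:
  fixes f g :: "'a \<Rightarrow> real"
  assumes "finite (set_pmf p)" "\<And>x. x \<in> set_pmf p \<Longrightarrow> f x \<le> g x"
  shows "measure_pmf.expectation p f \<le> measure_pmf.expectation p g"
  using assms by (intro integral_mono_AE integrable_measure_pmf_finite) (auto simp: AE_measure_pmf_iff)

lemma expectation_cong_pmf:
  assumes "\<And>x. x \<in> set_pmf p \<Longrightarrow> f x = g x"
  shows "measure_pmf.expectation p f = measure_pmf.expectation p g"
  using assms by (intro integral_cong_AE) (auto simp: AE_measure_pmf_iff)

text \<open>Serves to bound the second stage for every outcome while the bound \<open>k\<close>
  still depends on the random first stage.\<close>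

lemma expectation_bind_le:
  fixes g :: "'b \<Rightarrow> real"
  assumes "finite (set_pmf p)" "\<And>x. x \<in> set_pmf p \<Longrightarrow> finite (set_pmf (f x))"
    and "\<And>x y. x \<in> set_pmf p \<Longrightarrow> y \<in> set_pmf (f x) \<Longrightarrow> g y \<le> k x"
  shows "measure_pmf.expectation (bind_pmf p f) g \<le> measure_pmf.expectation p k"
proof -
  have "measure_pmf.expectation (f x) g \<le> k x" if "x \<in> set_pmf p" for x
    using expectation_mono_finite[of "f x" g "\<lambda>_. k x"] assms that by simp
  then show ?thesis
    using assms by (subst expectation_bind_finite) (auto intro!: expectation_mono_finite)
qed

text \<open>Induction splits off one independent coordinate. The cross term is its inner product
  with the mean of the remaining sum, which vanishes; this is why both moments are proved
  together.\<close>

lemma Pi_pmf_centered_moments: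
  fixes f :: "'i \<Rightarrow> 'b \<Rightarrow> 'v::euclidean_space"
  assumes "finite A" "\<And>i. i \<in> A \<Longrightarrow> finite (set_pmf (p i))"
    and "\<And>i. i \<in> A \<Longrightarrow> measure_pmf.expectation (p i) (f i) = 0"
  shows "measure_pmf.expectation (Pi_pmf A d p) (\<lambda>\<omega>. \<Sum>i\<in>A. f i (\<omega> i)) = 0 \<and>
    measure_pmf.expectation (Pi_pmf A d p) (\<lambda>\<omega>. (norm (\<Sum>i\<in>A. f i (\<omega> i)))\<^sup>2)
      = (\<Sum>i\<in>A. measure_pmf.expectation (p i) (\<lambda>y. (norm (f i y))\<^sup>2))"
  using assms
proof (induction A rule: finite_induct)
  case empty
  then show ?case by simp
next
  case (insert j A)
  let ?Q = "Pi_pmf A d p"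
  have fj: "finite (set_pmf (p j))" and fQ: "finite (set_pmf ?Q)"
    using insert by (auto intro!: finite_set_Pi_pmf)
  note int = integrable_measure_pmf_finite[OF fj] integrable_measure_pmf_finite[OF fQ]
  define g where "g \<omega> = (\<Sum>i\<in>A. f i (\<omega> i))" for \<omega>
  have g0: "measure_pmf.expectation ?Q g = 0"
    and g2: "measure_pmf.expectation ?Q (\<lambda>\<omega>. (norm (g \<omega>))\<^sup>2)
      = (\<Sum>i\<in>A. measure_pmf.expectation (p i) (\<lambda>y. (norm (f i y))\<^sup>2))"
    using insert unfolding g_def by auto
  have split: "(\<Sum>i\<in>insert j A. f i ((fun_upd \<omega> j y) i)) = f j y + g \<omega>" for \<omega> y
    using insert unfolding g_def by (auto intro!: sum.cong)
  \<comment> \<open>General in the value type, since it is applied to the vector-valued sum and to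
    its real squared norm.\<close>
  have E: "measure_pmf.expectation (Pi_pmf (insert j A) d p) k =
      measure_pmf.expectation (p j) (\<lambda>y. measure_pmf.expectation ?Q (\<lambda>\<omega>. k (fun_upd \<omega> j y)))"
    for k :: "_ \<Rightarrow> 'w::euclidean_space"
    using insert fj fQ
    by (simp add: Pi_pmf_insert' expectation_bind_finite map_pmf_def[symmetric])
  have "measure_pmf.expectation (Pi_pmf (insert j A) d p) (\<lambda>\<omega>. \<Sum>i\<in>insert j A. f i (\<omega> i)) = 0"
    unfolding E split using g0 insert by (simp add: int Bochner_Integration.integral_add)
  moreover have "measure_pmf.expectation ?Q (\<lambda>\<omega>. (norm (f j y + g \<omega>))\<^sup>2)
      = (norm (f j y))\<^sup>2 + measure_pmf.expectation ?Q (\<lambda>\<omega>. (norm (g \<omega>))\<^sup>2)" for y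
  proof -
    have "measure_pmf.expectation ?Q (\<lambda>\<omega>. (norm (f j y + g \<omega>))\<^sup>2)
      = measure_pmf.expectation ?Q (\<lambda>\<omega>. (norm (f j y))\<^sup>2 + 2 * (f j y \<bullet> g \<omega>) + (norm (g \<omega>))\<^sup>2)"
      by (intro arg_cong[where f = "measure_pmf.expectation ?Q"] ext)
        (simp add: power2_norm_eq_inner inner_simps inner_commute)
    also have "\<dots> = (norm (f j y))\<^sup>2 + 2 * (f j y \<bullet> measure_pmf.expectation ?Q g)
        + measure_pmf.expectation ?Q (\<lambda>\<omega>. (norm (g \<omega>))\<^sup>2)"
      by (simp add: int)
    finally show ?thesis by (simp add: g0)
  qed
  then have "measure_pmf.expectation (Pi_pmf (insert j A) d p)
      (\<lambda>\<omega>. (norm (\<Sum>i\<in>insert j A. f i (\<omega> i)))\<^sup>2)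
      = (\<Sum>i\<in>insert j A. measure_pmf.expectation (p i) (\<lambda>y. (norm (f i y))\<^sup>2))"
    unfolding E split using insert g2 by (simp add: int)
  ultimately show ?case ..
qed

text \<open>Used for the B draws of a worker and again for the N workers; the first conclusion
  supplies the centering hypothesis of the second use.\<close>

lemma expectation_Pi_pmf_average_norm2:
  fixes f :: "'b \<Rightarrow> 'v::euclidean_space"
  assumes "N > 0" "finite (set_pmf p)" "measure_pmf.expectation p f = 0"
  shows "measure_pmf.expectation (Pi_pmf {..<N} d (\<lambda>_. p)) (\<lambda>\<omega>. (1 / real N) *\<^sub>R (\<Sum>i<N. f (\<omega> i))) = 0"
    and "measure_pmf.expectation (Pi_pmf {..<N} d (\<lambda>_. p))
        (\<lambda>\<omega>. (norm ((1 / real N) *\<^sub>R (\<Sum>i<N. f (\<omega> i))))\<^sup>2)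
      = measure_pmf.expectation p (\<lambda>y. (norm (f y))\<^sup>2) / real N"
  using Pi_pmf_centered_moments[of "{..<N}" "\<lambda>_. p" "\<lambda>_. f" d] assms
  by (auto simp: power_divide power2_eq_square)

lemma variance_le_second_moment:
  fixes X :: "'b \<Rightarrow> 'v::euclidean_space"
  assumes fin: "finite (set_pmf p)"
  shows "measure_pmf.expectation p (\<lambda>i. (norm (X i - measure_pmf.expectation p X))\<^sup>2)
    \<le> measure_pmf.expectation p (\<lambda>i. (norm (X i))\<^sup>2)"
proof -
  note int = integrable_measure_pmf_finite[OF fin]
  define M where "M = measure_pmf.expectation p X"
  have "measure_pmf.expectation p (\<lambda>i. (norm (X i - M))\<^sup>2)
    = measure_pmf.expectation p (\<lambda>i. (norm (X i))\<^sup>2 - 2 * (M \<bullet> X i) + (norm M)\<^sup>2)"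
    by (intro arg_cong[where f = "measure_pmf.expectation p"] ext)
      (simp add: power2_norm_eq_inner inner_simps inner_commute)
  also have "\<dots> = measure_pmf.expectation p (\<lambda>i. (norm (X i))\<^sup>2) - (norm M)\<^sup>2"
    by (simp add: int M_def[symmetric] power2_norm_eq_inner)
  finally show ?thesis by (simp add: M_def)
qed

section \<open>Quantization and aggregation errors\<close>

lemma finite_set_qscalar: "finite (set_pmf (qscalar \<delta> b x))"
  by (simp add: qscalar_def Let_def)

text \<open>Collects what holds for every outcome of a rounding: the range bounds control averages
  of quantized vectors, and the remaining cases give the error with and without clipping.\<close>

lemma qscalar_support:
  assumes b: "b \<ge> 2" and d: "\<delta> \<ge> 0" and y: "y \<in> set_pmf (qscalar \<delta> b x)"
  shows "- (2 ^ (b - 1)) * \<delta> \<le> y" "y \<le> (2 ^ (b - 1) - 1) * \<delta>"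
    and "\<delta> = 0 \<Longrightarrow> x = 0 \<Longrightarrow> y = x"
    and "\<delta> > 0 \<Longrightarrow> x < - (2 ^ (b - 1)) * \<delta> \<Longrightarrow> y = - (2 ^ (b - 1)) * \<delta>"
    and "\<delta> > 0 \<Longrightarrow> x > (2 ^ (b - 1) - 1) * \<delta> \<Longrightarrow> y = (2 ^ (b - 1) - 1) * \<delta>"
    and "\<delta> > 0 \<Longrightarrow> - (2 ^ (b - 1)) * \<delta> \<le> x \<Longrightarrow> x \<le> (2 ^ (b - 1) - 1) * \<delta> \<Longrightarrow> \<bar>y - x\<bar> \<le> \<delta>"
proof -
  define K :: int where "K = 2 ^ (b - 1)"
  have K: "(2::real) ^ (b - 1) = of_int K" by (simp add: K_def)
  have K1: "K \<ge> 1" by (simp add: K_def)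
  have main: "- K * \<delta> \<le> y \<and> y \<le> (K - 1) * \<delta> \<and> \<bar>y - x\<bar> \<le> \<delta>"
    if pos: "\<delta> > 0" and x: "- K * \<delta> \<le> x" "x \<le> (K - 1) * \<delta>"
  proof -
    define k where "k = \<lfloor>x / \<delta>\<rfloor>"
    have k: "of_int k * \<delta> \<le> x" "x < of_int k * \<delta> + \<delta>"
      using pos floor_correct[of "x / \<delta>"] unfolding k_def[symmetric] by (auto simp: field_simps)
    have "- K \<le> x / \<delta>" "x / \<delta> \<le> K - 1" using x pos by (auto simp: field_simps)
    then have kK: "- K \<le> k" "k \<le> K - 1" unfolding k_def by linarith+
    define pr where "pr = (of_int k * \<delta> + \<delta> - x) / \<delta>"
    have pr: "0 \<le> pr" "pr \<le> 1" using k pos by (auto simp: pr_def field_simps)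
    have "y \<in> (\<lambda>c. if c then of_int k * \<delta> else of_int k * \<delta> + \<delta>) ` set_pmf (bernoulli_pmf pr)"
      using y x pos unfolding qscalar_def K k_def[symmetric] pr_def by (simp add: Let_def)
    then obtain c where c: "c \<in> set_pmf (bernoulli_pmf pr)"
      "y = (if c then of_int k * \<delta> else of_int k * \<delta> + \<delta>)" by blast
    show ?thesis
    proof (cases c)
      case True
      have "- of_int K * \<delta> \<le> of_int k * \<delta>" "of_int k * \<delta> \<le> of_int (K - 1) * \<delta>"
        using kK pos by (auto intro!: mult_right_mono simp flip: of_int_minus)
      then show ?thesis using True c k pos by auto
    next
      case False
      \<comment> \<open>Rounding up has positive probability only if x lies strictly above the grid
        point k \<delta>. Then k < K - 1, so k + 1 is still a grid index and the upper end of the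
        grid is not exceeded.\<close>
      then have "pmf (bernoulli_pmf pr) False \<noteq> 0" using c by (simp add: set_pmf_iff)
      then have "pr < 1" using pr by simp
      then have "of_int k * \<delta> < x" using pos by (simp add: pr_def field_simps)
      also have "x \<le> of_int (K - 1) * \<delta>" using x by simp
      finally have "k < K - 1" using pos by (simp only: mult_less_cancel_right_pos of_int_less_iff)
      then have "- of_int K * \<delta> \<le> of_int (k + 1) * \<delta>" "of_int (k + 1) * \<delta> \<le> of_int (K - 1) * \<delta>"
        using kK pos by (auto intro!: mult_right_mono simp flip: of_int_minus simp del: of_int_add of_int_diff)
      then show ?thesis using False c k pos by (auto simp: algebra_simps)
    qed
  qed
  have le: "- K * \<delta> \<le> (K - 1) * \<delta>" using K1 d by (intro mult_right_mono) auto
  have z: "\<delta> = 0 \<Longrightarrow> y = 0" using y by (simp add: qscalar_def)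
  have lo: "\<delta> > 0 \<Longrightarrow> x < - K * \<delta> \<Longrightarrow> y = - K * \<delta>"
    using y unfolding qscalar_def K by simp
  have hi: "\<delta> > 0 \<Longrightarrow> x > (K - 1) * \<delta> \<Longrightarrow> y = (K - 1) * \<delta>"
    using y le unfolding qscalar_def K by (auto split: if_splits)
  show "- (2 ^ (b - 1)) * \<delta> \<le> y" "y \<le> (2 ^ (b - 1) - 1) * \<delta>"
    "\<delta> = 0 \<Longrightarrow> x = 0 \<Longrightarrow> y = x"
    "\<delta> > 0 \<Longrightarrow> x < - (2 ^ (b - 1)) * \<delta> \<Longrightarrow> y = - (2 ^ (b - 1)) * \<delta>"
    "\<delta> > 0 \<Longrightarrow> x > (2 ^ (b - 1) - 1) * \<delta> \<Longrightarrow> y = (2 ^ (b - 1) - 1) * \<delta>"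
    "\<delta> > 0 \<Longrightarrow> - (2 ^ (b - 1)) * \<delta> \<le> x \<Longrightarrow> x \<le> (2 ^ (b - 1) - 1) * \<delta> \<Longrightarrow> \<bar>y - x\<bar> \<le> \<delta>"
    unfolding K using main le z lo hi d by (cases "\<delta> = 0"; force)+
qed

lemma set_qvec: "y \<in> set_pmf (qvec \<delta> b v) \<Longrightarrow> y $ j \<in> set_pmf (qscalar \<delta> b (v $ j))"
  by (auto simp: qvec_def set_Pi_pmf PiE_dflt_def)

lemma finite_set_qvec: "finite (set_pmf (qvec \<delta> b v))"
  by (auto simp: qvec_def intro!: finite_set_Pi_pmf finite_set_qscalar)

lemma abs_component_le_infnorm: "\<bar>x $ j\<bar> \<le> infnorm (x :: real^'d)"
  using Basis_le_infnorm[of "axis j 1" x] by (simp add: inner_axis axis_in_Basis_iff)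

lemma norm_square_vec: "(norm (x :: real^'d))\<^sup>2 = (\<Sum>j\<in>UNIV. (x $ j)\<^sup>2)"
  unfolding power2_norm_eq_inner inner_vec_def by (simp add: power2_eq_square)

text \<open>An unclipped coordinate moves by at most \<delta>. A clipped one has modulus at most
  \<open>infnorm u\<close> and is moved to an endpoint of modulus at least
  \<open>lam * infnorm u\<close>. For simplicity the term in \<delta> is charged to every
  coordinate.\<close>

lemma qvec_error_le:
  fixes u :: "real^'d"
  assumes b: "b \<ge> 2" and d: "\<delta> \<ge> 0" and z: "\<delta> = 0 \<Longrightarrow> u = 0"
    and lam: "lam * infnorm u \<le> (2 ^ (b - 1) - 1) * \<delta>"
    and y: "y \<in> set_pmf (qvec \<delta> b u)"
  shows "(norm (y - u))\<^sup>2 \<le> real CARD('d) * \<delta>\<^sup>2 + real (n_outside b \<delta> u) * ((1 - lam) * infnorm u)\<^sup>2"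
proof -
  define Out where "Out = {j. u $ j < - (2 ^ (b - 1)) * \<delta> \<or> u $ j > (2 ^ (b - 1) - 1) * \<delta>}"
  have "((y - u) $ j)\<^sup>2 \<le> \<delta>\<^sup>2 + (if j \<in> Out then ((1 - lam) * infnorm u)\<^sup>2 else 0)" for j
  proof (cases "\<delta> = 0")
    case True
    then show ?thesis using qscalar_support(3)[OF b d set_qvec[OF y], of j] z by auto
  next
    case False
    then have pos: "\<delta> > 0" using d by simp
    note s = qscalar_support(4-)[OF b d set_qvec[OF y], of j, OF pos]
    have u: "\<bar>u $ j\<bar> \<le> infnorm u" by (rule abs_component_le_infnorm)
    show ?thesis
    proof (cases "j \<in> Out")
      case True
      have "\<bar>y $ j - u $ j\<bar> \<le> (1 - lam) * infnorm u"
      proof (cases "u $ j < - (2 ^ (b - 1)) * \<delta>")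
        case True
        then show ?thesis using s(1) u lam pos by (simp add: algebra_simps)
      next
        case False
        then have "u $ j > (2 ^ (b - 1) - 1) * \<delta>" using \<open>j \<in> Out\<close> by (simp add: Out_def)
        then show ?thesis using s(2) u lam by (simp add: algebra_simps)
      qed
      then have "(y $ j - u $ j)\<^sup>2 \<le> ((1 - lam) * infnorm u)\<^sup>2"
        by (metis abs_ge_zero power2_abs power_mono)
      then show ?thesis using True by (simp add: add_increasing)
    next
      case False
      then have "\<bar>y $ j - u $ j\<bar> \<le> \<delta>" using s(3) by (simp add: Out_def)
      then have "(y $ j - u $ j)\<^sup>2 \<le> \<delta>\<^sup>2" by (metis abs_ge_zero power2_abs power_mono)
      then show ?thesis using False by simp
    qed
  qed
  then have "(norm (y - u))\<^sup>2 \<le> (\<Sum>j\<in>UNIV. \<delta>\<^sup>2 + (if j \<in> Out then ((1 - lam) * infnorm u)\<^sup>2 else 0))"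
    unfolding norm_square_vec by (rule sum_mono)
  also have "\<dots> = real CARD('d) * \<delta>\<^sup>2 + real (card Out) * ((1 - lam) * infnorm u)\<^sup>2"
    by (simp add: sum.distrib sum.If_cases)
  finally show ?thesis by (simp add: Out_def n_outside_def)
qed

lemma qvec_error_in_range:
  fixes v :: "real^'d"
  assumes b: "b \<ge> 2" and d: "\<delta> \<ge> 0"
    and v: "\<And>j. - (2 ^ (b - 1)) * \<delta> \<le> v $ j" "\<And>j. v $ j \<le> (2 ^ (b - 1) - 1) * \<delta>"
    and y: "y \<in> set_pmf (qvec \<delta> b v)"
  shows "(norm (y - v))\<^sup>2 \<le> real CARD('d) * \<delta>\<^sup>2"
proof -
  have "((y - v) $ j)\<^sup>2 \<le> \<delta>\<^sup>2" for j
  proof -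
    have "\<bar>y $ j - v $ j\<bar> \<le> \<delta>"
    proof (cases "\<delta> = 0")
      case True
      then show ?thesis using qscalar_support(3)[OF b d set_qvec[OF y], of j] v[of j] by auto
    next
      case False
      then show ?thesis using qscalar_support(6)[OF b d set_qvec[OF y], of j] v[of j] d by auto
    qed
    then show ?thesis by (metis abs_ge_zero power2_abs power_mono vector_minus_component)
  qed
  then have "(norm (y - v))\<^sup>2 \<le> (\<Sum>j\<in>(UNIV::'d set). \<delta>\<^sup>2)"
    unfolding norm_square_vec by (intro sum_mono)
  then show ?thesis by simp
qed

text \<open>Telescoping and Cauchy-Schwarz bound the j-th squared displacement by j times the sum of
  all squared steps; summing j over j < m gives at most half of the square of m.\<close>

lemma sum_norm_displacement_le:
  fixes x :: "nat \<Rightarrow> 'a::real_normed_vector"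
  shows "(\<Sum>j<m. (norm (x j - x 0))\<^sup>2) \<le> (real m)\<^sup>2 / 2 * (\<Sum>j<m. (norm (x (Suc j) - x j))\<^sup>2)"
proof -
  define A where "A = (\<Sum>j<m. (norm (x (Suc j) - x j))\<^sup>2)"
  have A0: "A \<ge> 0" unfolding A_def by (intro sum_nonneg) auto
  have "(norm (x j - x 0))\<^sup>2 \<le> real j * A" if "j < m" for j
  proof -
    have "norm (x j - x 0) = norm (\<Sum>i<j. x (Suc i) - x i)"
      by (simp add: sum_lessThan_telescope)
    also have "\<dots> \<le> (\<Sum>i<j. norm (x (Suc i) - x i))" by (rule norm_sum)
    finally have "(norm (x j - x 0))\<^sup>2 \<le> (\<Sum>i<j. norm (x (Suc i) - x i))\<^sup>2" by (simp add: power_mono)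
    also have "\<dots> \<le> real j * (\<Sum>i<j. (norm (x (Suc i) - x i))\<^sup>2)"
      using sum_squared_le_sum_of_squares[of "\<lambda>i. norm (x (Suc i) - x i)" "{..<j}"] by (simp add: mult.commute)
    also have "\<dots> \<le> real j * A" unfolding A_def
      using that by (intro mult_left_mono sum_mono2) auto
    finally show ?thesis .
  qed
  then have "(\<Sum>j<m. (norm (x j - x 0))\<^sup>2) \<le> (\<Sum>j<m. real j * A)" by (intro sum_mono) auto
  also have "\<dots> = (\<Sum>j<m. real j) * A" by (simp add: sum_distrib_right)
  also have "\<dots> \<le> (real m)\<^sup>2 / 2 * A"
  proof (rule mult_right_mono[OF _ A0])
    show "(\<Sum>j<m. real j) \<le> (real m)\<^sup>2 / 2"
      by (induction m) (auto simp: power2_eq_square field_simps)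
  qed
  finally show ?thesis unfolding A_def .
qed

lemma norm_sum3_square_le:
  fixes a b c :: "'a::real_inner"
  shows "(norm (a + b + c))\<^sup>2 \<le> 3 * ((norm a)\<^sup>2 + (norm b)\<^sup>2 + (norm c)\<^sup>2)"
proof -
  have "0 \<le> (norm (a - b))\<^sup>2 + (norm (b - c))\<^sup>2 + (norm (a - c))\<^sup>2" by simp
  then show ?thesis unfolding power2_norm_eq_inner by (simp add: inner_simps inner_commute)
qed

section \<open>One iteration, conditioned on the sampled batches\<close>

definition used_scale :: "scheme \<Rightarrow> real \<Rightarrow> nat \<Rightarrow> nat \<Rightarrow> (nat \<Rightarrow> real^'d) \<Rightarrow> nat \<Rightarrow> real" where
  "used_scale sch lam b N u i =
     (if sch = SchemeA then lam * infnorm (u i) / (2 ^ (b - 1) - 1)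
      else Max ((\<lambda>i. lam * infnorm (u i) / (2 ^ (b - 1) - 1)) ` {..<N}))"

text \<open>Under \<open>SchemeC\<close> the scale is a maximum over all workers and does not depend
  on the worker, so index 0 merely represents the common scale.\<close>

definition aggregate :: "scheme \<Rightarrow> real \<Rightarrow> nat \<Rightarrow> nat \<Rightarrow> (nat \<Rightarrow> real^'d) \<Rightarrow> (nat \<Rightarrow> real^'d) \<Rightarrow> (real^'d) pmf" where
  "aggregate sch lam b N u q =
     (if sch = SchemeC then qvec (used_scale sch lam b N u 0) b ((1 / real N) *\<^sub>R (\<Sum>i<N. q i))
      else return_pmf ((1 / real N) *\<^sub>R (\<Sum>i<N. q i)))"

definition batches :: "nat \<Rightarrow> nat \<Rightarrow> nat \<Rightarrow> (nat \<Rightarrow> nat \<Rightarrow> nat) pmf" where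
  "batches n N B = Pi_pmf {..<N} (\<lambda>_. 0) (\<lambda>i. Pi_pmf {..<B} 0 (\<lambda>_. pmf_of_set {1..n}))"

text \<open>Separates the rounding stage from the sampling of indices, so that rounding can be
  bounded outcome by outcome and sampling in expectation.\<close>

definition step_given_batches where
  "step_given_batches sch gf h n N B \<eta> lam b xt x Is =
     (let u = (\<lambda>i. mb_u gf B xt x (Is i)) in
      bind_pmf (Pi_pmf {..<N} 0 (\<lambda>i. qvec (used_scale sch lam b N u i) b (u i)))
        (\<lambda>q. map_pmf (\<lambda>ut. (prox \<eta> h (x - \<eta> *\<^sub>R (ut + full_grad gf n xt)),
                             map (\<lambda>i. (u i, used_scale sch lam b N u i)) [0..<N]))
               (aggregate sch lam b N u q)))"

lemma lpc_step_eq: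
  "lpc_step sch gf h n N B \<eta> lam b xt x
     = bind_pmf (batches n N B) (step_given_batches sch gf h n N B \<eta> lam b xt x)"
  unfolding lpc_step_def batches_def step_given_batches_def aggregate_def used_scale_def Let_def
  by (cases "sch = SchemeA") (auto intro!: bind_pmf_cong)

lemma finite_set_batches: "n > 0 \<Longrightarrow> finite (set_pmf (batches n N B))"
  unfolding batches_def by (intro finite_set_Pi_pmf) auto

lemma batches_in_range:
  "n > 0 \<Longrightarrow> Is \<in> set_pmf (batches n N B) \<Longrightarrow> i < N \<Longrightarrow> a < B \<Longrightarrow> Is i a \<in> {1..n}"
  by (auto simp: batches_def set_Pi_pmf PiE_dflt_def)

lemma finite_set_step_given_batches:
  "finite (set_pmf (step_given_batches sch gf h n N B \<eta> lam b xt x Is))"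
  unfolding step_given_batches_def aggregate_def
  by (auto simp: Let_def finite_set_qvec intro!: finite_UN_I finite_set_Pi_pmf)

text \<open>The scale must be large enough that clipping costs only a fraction 1 - lam, yet small
  enough to be controlled by D. Taking the maximum over workers preserves both, and it vanishes only
  if every stochastic difference does.\<close>

lemma used_scale_bounds:
  fixes u :: "nat \<Rightarrow> real^'d"
  assumes b: "b \<ge> 2" and lam: "0 < lam" and u: "\<And>i. i < N \<Longrightarrow> norm (u i) \<le> D" and i: "i < N"
  shows "0 \<le> used_scale sch lam b N u i"
    and "lam * infnorm (u i) \<le> (2 ^ (b - 1) - 1) * used_scale sch lam b N u i"
    and "used_scale sch lam b N u i \<le> lam * D / (2 ^ (b - 1) - 1)"
    and "used_scale sch lam b N u i = 0 \<Longrightarrow> u i = 0"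
proof -
  define q :: real where "q = 2 ^ (b - 1) - 1"
  have "(2::real) ^ 1 \<le> 2 ^ (b - 1)" using b by (intro power_increasing) auto
  then have q: "q > 0" by (simp add: q_def)
  define di where "di i = lam * infnorm (u i) / q" for i
  have di0: "di i \<ge> 0" for i using lam q by (simp add: di_def infnorm_pos_le)
  have diD: "di i \<le> lam * D / q" if "i < N" for i
    using u[OF that] infnorm_le_norm[of "u i"] lam q unfolding di_def
    by (intro divide_right_mono mult_left_mono) auto
  have s: "used_scale sch lam b N u i = (if sch = SchemeA then di i else Max (di ` {..<N}))"
    unfolding used_scale_def q_def[symmetric] di_def by simp
  have ge: "di i \<le> used_scale sch lam b N u i" using i by (simp add: s)
  show "0 \<le> used_scale sch lam b N u i" using ge di0[of i] by linarith
  have eq: "lam * infnorm (u i) = q * di i" using q by (simp add: di_def)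
  then show l: "lam * infnorm (u i) \<le> (2 ^ (b - 1) - 1) * used_scale sch lam b N u i"
    using ge q unfolding q_def[symmetric] by simp
  show "used_scale sch lam b N u i \<le> lam * D / (2 ^ (b - 1) - 1)"
    unfolding q_def[symmetric] s using i diD by (auto intro!: Max.boundedI)
  show "u i = 0" if "used_scale sch lam b N u i = 0"
    using l lam that infnorm_pos_lt[of "u i"] by (auto simp: mult_le_0_iff)
qed

lemma norm_average_le:
  fixes e :: "nat \<Rightarrow> 'a::real_normed_vector"
  assumes "N > 0" "\<And>i. i < N \<Longrightarrow> norm (e i) \<le> r"
  shows "norm ((1 / real N) *\<^sub>R (\<Sum>i<N. e i)) \<le> r"
proof -
  have "norm (\<Sum>i<N. e i) \<le> real N * r" using sum_norm_le[of "{..<N}" e "\<lambda>_. r"] assms by simp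
  then show ?thesis using assms by (simp add: field_simps)
qed

text \<open>Both bounds hold for every outcome. Each worker's error is bounded by the same radius
  and averaging does not increase it. \<open>Q\<close> bounds d squared grid widths relative to the
  square of D.\<close>

lemma aggregate_error:
  fixes u q :: "nat \<Rightarrow> real^'d"
  assumes N: "N > 0" and b: "b \<ge> 2" and lam: "0 < lam" "lam \<le> 1"
    and u: "\<And>i. i < N \<Longrightarrow> norm (u i) \<le> D"
    and out: "\<And>i. i < N \<Longrightarrow> real (n_outside b (used_scale sch lam b N u i) (u i)) \<le> dlam"
    and q: "q \<in> set_pmf (Pi_pmf {..<N} 0 (\<lambda>i. qvec (used_scale sch lam b N u i) b (u i)))"
    and ut: "ut \<in> set_pmf (aggregate sch lam b N u q)"
  defines "Q \<equiv> real CARD('d) * lam\<^sup>2 / (2 ^ (b - 1) - 1)\<^sup>2"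
  shows "(norm ((1 / real N) *\<^sub>R (\<Sum>i<N. q i) - (1 / real N) *\<^sub>R (\<Sum>i<N. u i)))\<^sup>2
      \<le> D\<^sup>2 * (Q + dlam * (1 - lam)\<^sup>2)" (is "?A")
    and "(norm (ut - (1 / real N) *\<^sub>R (\<Sum>i<N. q i)))\<^sup>2 \<le> D\<^sup>2 * (if sch = SchemeC then Q else 0)" (is "?B")
proof -
  let ?s = "used_scale sch lam b N u"
  note sb = used_scale_bounds[OF b lam(1), of N u D]
  have qi: "q i \<in> set_pmf (qvec (?s i) b (u i))" if "i < N" for i
    using q that by (auto simp: set_Pi_pmf PiE_dflt_def)
  have sQ: "real CARD('d) * (?s i)\<^sup>2 \<le> D\<^sup>2 * Q" if "i < N" for i
  proof -
    have "(?s i)\<^sup>2 \<le> (lam * D / (2 ^ (b - 1) - 1))\<^sup>2"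
      using sb[OF u that] by (intro power_mono) auto
    then have "real CARD('d) * (?s i)\<^sup>2 \<le> real CARD('d) * (lam * D / (2 ^ (b - 1) - 1))\<^sup>2"
      by (intro mult_left_mono) auto
    then show ?thesis by (simp add: Q_def power_divide power_mult_distrib mult_ac)
  qed
  have "norm (q i - u i) \<le> sqrt (D\<^sup>2 * (Q + dlam * (1 - lam)\<^sup>2))" if i: "i < N" for i
  proof (rule real_le_rsqrt)
    have "(norm (q i - u i))\<^sup>2 \<le> real CARD('d) * (?s i)\<^sup>2
        + real (n_outside b (?s i) (u i)) * ((1 - lam) * infnorm (u i))\<^sup>2"
      using sb[OF u i] by (intro qvec_error_le[OF b _ _ _ qi[OF i]]) auto
    also have "\<dots> \<le> D\<^sup>2 * Q + dlam * ((1 - lam) * D)\<^sup>2"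
    proof (intro add_mono sQ[OF i] mult_mono out[OF i] power_mono)
      show "infnorm (u i) \<le> D" using u[OF i] infnorm_le_norm[of "u i"] by linarith
      show "0 \<le> dlam" using out[OF i] by linarith
    qed (use lam in \<open>auto simp: infnorm_pos_le\<close>)
    finally show "(norm (q i - u i))\<^sup>2 \<le> D\<^sup>2 * (Q + dlam * (1 - lam)\<^sup>2)"
      by (simp only: power_mult_distrib distrib_left mult_ac)
  qed
  from norm_average_le[OF N this]
  have "norm ((1 / real N) *\<^sub>R (\<Sum>i<N. q i - u i)) \<le> sqrt (D\<^sup>2 * (Q + dlam * (1 - lam)\<^sup>2))" .
  moreover have "0 \<le> D\<^sup>2 * (Q + dlam * (1 - lam)\<^sup>2)"
    using out[OF N] by (simp add: Q_def)
  ultimately have "(norm ((1 / real N) *\<^sub>R (\<Sum>i<N. q i - u i)))\<^sup>2 \<le> D\<^sup>2 * (Q + dlam * (1 - lam)\<^sup>2)"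
    by (metis norm_ge_zero power_mono real_sqrt_pow2)
  then show ?A by (simp add: sum_subtractf scaleR_diff_right)
  show ?B
  proof (cases "sch = SchemeC")
    case True
    have s0: "?s i = ?s 0" for i by (simp add: True used_scale_def)
    have d0: "?s 0 \<ge> 0" using sb(1)[OF u N] by simp
    \<comment> \<open>All quantized vectors lie in the range of the common grid, hence so does their
      average, and the second rounding never clips.\<close>
    have rng: "- (2 ^ (b - 1)) * ?s 0 \<le> q i $ j \<and> q i $ j \<le> (2 ^ (b - 1) - 1) * ?s 0" if "i < N" for i j
      using qscalar_support(1,2)[OF b d0 set_qvec, of "q i" "u i" j] qi[OF that] s0[of i] by auto
    have "(norm (ut - (1 / real N) *\<^sub>R (\<Sum>i<N. q i)))\<^sup>2 \<le> real CARD('d) * (?s 0)\<^sup>2"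
    proof (rule qvec_error_in_range[OF b d0])
      show "ut \<in> set_pmf (qvec (?s 0) b ((1 / real N) *\<^sub>R (\<Sum>i<N. q i)))"
        using ut True by (simp add: aggregate_def)
      show "- (2 ^ (b - 1)) * ?s 0 \<le> ((1 / real N) *\<^sub>R (\<Sum>i<N. q i)) $ j" for j
        using sum_bounded_below[of "{..<N}" "- (2 ^ (b - 1)) * ?s 0" "\<lambda>i. q i $ j"] rng N
        by (simp add: field_simps)
      show "((1 / real N) *\<^sub>R (\<Sum>i<N. q i)) $ j \<le> (2 ^ (b - 1) - 1) * ?s 0" for j
        using sum_bounded_above[of "{..<N}" "\<lambda>i. q i $ j" "(2 ^ (b - 1) - 1) * ?s 0"] rng N
        by (simp add: field_simps)
    qed
    then show ?thesis using sQ[OF N] True by simp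
  next
    case False
    then show ?thesis using ut by (simp add: aggregate_def)
  qed
qed

section \<open>Sampling error of the minibatches\<close>

lemma mb_u_norm_le:
  assumes B: "B > 0" and "\<And>a. a < B \<Longrightarrow> I a \<in> {1..n}"
    and "\<And>i. i \<in> {1..n} \<Longrightarrow> norm (gf i x - gf i xt) \<le> D"
  shows "norm (mb_u gf B xt x I) \<le> D"
  unfolding mb_u_def using assms by (intro norm_average_le) auto

text \<open>Subtracting the full gradient difference \<open>?T\<close> from each draw makes the
  draws centered. Averaging over B draws and then over N independent workers divides the variance of
  one draw by B and by N, and that variance is at most the second moment.\<close>

lemma minibatch_variance:
  fixes gf :: "nat \<Rightarrow> real^'d \<Rightarrow> real^'d"
  assumes n: "n > 0" and N: "N > 0" and B: "B > 0"
    and D: "\<And>i. i \<in> {1..n} \<Longrightarrow> norm (gf i x - gf i xt) \<le> D"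
  shows "measure_pmf.expectation (batches n N B)
     (\<lambda>Is. (norm ((1 / real N) *\<^sub>R (\<Sum>i<N. mb_u gf B xt x (Is i)) - (full_grad gf n x - full_grad gf n xt)))\<^sup>2)
     \<le> D\<^sup>2 / (real N * real B)"
proof -
  let ?p = "pmf_of_set {1..n}"
  let ?T = "full_grad gf n x - full_grad gf n xt"
  define X where "X i = gf i x - gf i xt" for i
  have fin: "finite (set_pmf ?p)" and set: "set_pmf ?p = {1..n}" using n by auto
  have ET: "measure_pmf.expectation ?p X = ?T"
    using n unfolding X_def full_grad_def
    by (subst integral_measure_pmf[where A = "{1..n}"])
      (auto simp: sum_subtractf scaleR_diff_right scaleR_sum_right divide_inverse)
  have E0: "measure_pmf.expectation ?p (\<lambda>i. X i - ?T) = 0"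
    by (subst Bochner_Integration.integral_diff) (simp_all only: integrable_measure_pmf_finite[OF fin] ET, simp)
  have "measure_pmf.expectation ?p (\<lambda>i. (norm (X i - ?T))\<^sup>2) \<le> measure_pmf.expectation ?p (\<lambda>i. (norm (X i))\<^sup>2)"
    using variance_le_second_moment[OF fin, of X] unfolding ET .
  also have "\<dots> \<le> measure_pmf.expectation ?p (\<lambda>i. D\<^sup>2)"
    using D set by (intro expectation_mono_finite fin power_mono) (auto simp: X_def)
  finally have V1: "measure_pmf.expectation ?p (\<lambda>i. (norm (X i - ?T))\<^sup>2) \<le> D\<^sup>2" by simp
  let ?PB = "Pi_pmf {..<B} 0 (\<lambda>_. ?p)"
  have center: "mb_u gf B xt x I - ?T = (1 / real B) *\<^sub>R (\<Sum>a<B. X (I a) - ?T)" for I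
    using B by (simp add: mb_u_def X_def sum_subtractf[of _ "\<lambda>_. ?T"] scaleR_diff_right[of "1 / real B"] sum_constant_scaleR del: sum_constant)
  note mB = expectation_Pi_pmf_average_norm2[OF B fin E0, of 0, folded center]
  have finB: "finite (set_pmf ?PB)" using fin by (intro finite_set_Pi_pmf) auto
  have center': "(1 / real N) *\<^sub>R (\<Sum>i<N. mb_u gf B xt x (Is i)) - ?T
      = (1 / real N) *\<^sub>R (\<Sum>i<N. mb_u gf B xt x (Is i) - ?T)" for Is
    using N by (simp add: sum_subtractf[of _ "\<lambda>_. ?T"] scaleR_diff_right[of "1 / real N"] sum_constant_scaleR del: sum_constant)
  show ?thesis
    unfolding center' batches_def expectation_Pi_pmf_average_norm2(2)[OF N finB mB(1)] mB(2)
    using V1 N B by (simp add: field_simps)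
qed

section \<open>Convergence of LPC-SVRG\<close>

definition mean_fun :: "(nat \<Rightarrow> 'a \<Rightarrow> real) \<Rightarrow> nat \<Rightarrow> 'a \<Rightarrow> real" where
  "mean_fun fs n x = (1 / real n) * (\<Sum>i=1..n. fs i x)"

text \<open>The two step size conditions are merged in \<open>cond\<close>: only the factor of the
  grid term, 3/8 or 1/4, depends on the scheme.\<close>

locale lpc_svrg =
  fixes fs :: "nat \<Rightarrow> real^'d \<Rightarrow> real" and gf :: "nat \<Rightarrow> real^'d \<Rightarrow> real^'d" and h :: "real^'d \<Rightarrow> ereal"
    and n N m B b :: nat and L \<rho> lam dlam :: real and sch :: scheme and xstar :: "real^'d"
  assumes n_pos: "n > 0" and N_pos: "N > 0" and m_pos: "m > 0" and B_pos: "B > 0"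
    and grad: "\<And>i x. i \<in> {1..n} \<Longrightarrow> (fs i has_derivative (\<lambda>v. gf i x \<bullet> v)) (at x)"
    and L_pos': "L > 0"
    and lip: "\<And>i x y. i \<in> {1..n} \<Longrightarrow> norm (gf i x - gf i y) \<le> L * norm (x - y)"
    and h_proper': "proper_fun h" and h_convex': "convex_ext h" and h_lsc': "lsc_fun h"
    and xstar_min': "\<And>x. ereal (mean_fun fs n xstar) + h xstar \<le> ereal (mean_fun fs n x) + h x"
    and b_ge: "b \<ge> 2"
    and lam: "0 < lam" "lam \<le> 1"
    and rho: "0 < \<rho>" "\<rho> < 1 / 2"
    and dlam_nonneg: "dlam \<ge> 0"
    and cond: "8 * (real m)\<^sup>2 * \<rho>\<^sup>2 * ((if sch = SchemeC then 3 / 8 else 1 / 4)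
                   * (real CARD('d) * lam\<^sup>2 / (2 ^ (b - 1) - 1)\<^sup>2)
                 + dlam * (1 - lam)\<^sup>2 + 1 / (real N * real B)) + \<rho> \<le> 1"
begin

abbreviation "\<eta> \<equiv> \<rho> / L"
abbreviation "step \<equiv> lpc_step sch gf h n N B \<eta> lam b"
abbreviation "inner_loop \<equiv> lpc_inner sch gf h n N B \<eta> lam b"
abbreviation "outer_loop \<equiv> lpc_outer sch gf h n N B \<eta> lam b m"
abbreviation "gnorm2 x \<equiv> (norm (grad_map \<eta> h (full_grad gf n) x))\<^sup>2"

sublocale composite "mean_fun fs n" "full_grad gf n" h L \<eta> xstar
proof
  show "(mean_fun fs n has_derivative (\<lambda>v. full_grad gf n x \<bullet> v)) (at x)" for x
  proof -
    have "((\<lambda>x. (1 / real n) * (\<Sum>i=1..n. fs i x)) has_derivative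
        (\<lambda>v. (1 / real n) * (\<Sum>i=1..n. gf i x \<bullet> v))) (at x)"
      by (intro has_derivative_mult_right has_derivative_sum grad)
    then show ?thesis by (simp add: full_grad_def inner_sum_left mean_fun_def[abs_def])
  qed
  show "norm (full_grad gf n x - full_grad gf n y) \<le> L * norm (x - y)" for x y
  proof -
    have "norm (\<Sum>i=1..n. gf i x - gf i y) \<le> real n * (L * norm (x - y))"
      using sum_norm_le[of "{1..n}" "\<lambda>i. gf i x - gf i y" "\<lambda>_. L * norm (x - y)"] lip by simp
    moreover have "full_grad gf n x - full_grad gf n y = (1 / real n) *\<^sub>R (\<Sum>i=1..n. gf i x - gf i y)"
      unfolding full_grad_def sum_subtractf by (rule scaleR_diff_right[symmetric])
    ultimately show ?thesis using n_pos by (simp add: divide_le_eq mult.commute)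
  qed
  show "\<eta> > 0" "\<eta> * L < 1" using L_pos' rho by auto
qed (fact L_pos' h_proper' h_convex' h_lsc' xstar_min')+

section \<open>Constants and the expected descent of one iteration\<close>

definition noise :: real where
  "noise = (if sch = SchemeC then 3 / 8 else 1 / 4) * (real CARD('d) * lam\<^sup>2 / (2 ^ (b - 1) - 1)\<^sup>2)
     + dlam * (1 - lam)\<^sup>2 + 1 / (real N * real B)"

text \<open>\<open>\<alpha>\<close> and \<open>\<beta>\<close> are the coefficients of
  \<open>inexact_prox_step\<close> at \<eta> L = \<rho>. \<open>\<gamma>\<close> is \<eta> / 2 times
  the factor 16 from the error estimate, times the square of L and \<open>noise\<close>.\<close>

definition \<alpha> :: real where "\<alpha> = \<eta> / 2 * (1 - 2 * \<rho>)"
definition \<beta> :: real where "\<beta> = 1 / (2 * \<eta>) - L / 2"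
definition \<gamma> :: real where "\<gamma> = 8 * \<eta> * L\<^sup>2 * noise"

lemma \<alpha>_pos: "\<alpha> > 0"
  using rho L_pos by (simp add: \<alpha>_def)

lemma noise_nonneg: "noise \<ge> 0"
  using dlam_nonneg by (simp add: noise_def)

lemma \<gamma>_nonneg: "\<gamma> \<ge> 0"
  using noise_nonneg rho L_pos by (simp add: \<gamma>_def)

text \<open>This is the step size condition multiplied by L / (2 \<rho>).\<close>

lemma \<gamma>_le_\<beta>: "\<gamma> * ((real m)\<^sup>2 / 2) \<le> \<beta>"
proof -
  have "8 * (real m)\<^sup>2 * \<rho>\<^sup>2 * noise \<le> 1 - \<rho>" using cond unfolding noise_def by linarith
  then have "L / (2 * \<rho>) * (8 * (real m)\<^sup>2 * \<rho>\<^sup>2 * noise) \<le> L / (2 * \<rho>) * (1 - \<rho>)"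
    using rho L_pos by (intro mult_left_mono) auto
  moreover have "L / (2 * \<rho>) * (8 * (real m)\<^sup>2 * \<rho>\<^sup>2 * noise) = \<gamma> * ((real m)\<^sup>2 / 2)"
    using rho L_pos by (simp add: \<gamma>_def power2_eq_square field_simps)
  moreover have "L / (2 * \<rho>) * (1 - \<rho>) = \<beta>"
    using rho L_pos by (simp add: \<beta>_def field_simps)
  ultimately show ?thesis by simp
qed

text \<open>The almost sure clipping bound in terms of the support. The first component is left
  polymorphic so that one predicate serves a single step, an epoch and the whole run.\<close>

definition log_ok :: "('a \<times> ((real^'d) \<times> real) list) pmf \<Rightarrow> bool" where
  "log_ok p \<longleftrightarrow> (\<forall>\<omega>\<in>set_pmf p. \<forall>(u, \<delta>)\<in>set (snd \<omega>). real (n_outside b \<delta> u) \<le> dlam)"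

lemma finite_set_step: "finite (set_pmf (step xt x))"
  unfolding lpc_step_eq set_bind_pmf
  by (intro finite_UN_I finite_set_batches[OF n_pos] finite_set_step_given_batches)

lemma h_step: "\<omega> \<in> set_pmf (step xt x) \<Longrightarrow> h (fst \<omega>) \<noteq> \<infinity>"
  unfolding lpc_step_eq step_given_batches_def Let_def set_bind_pmf set_map_pmf
  by (elim UN_E imageE) (simp add: h_prox)

text \<open>The gradient error is split into the sampling error and two rounding errors; the latter are
  bounded on the whole support, so that only the sampling error needs an expectation.\<close>

lemma step_bound:
  assumes hx: "h x \<noteq> \<infinity>" and ok: "log_ok (step xt x)"
    and Is: "Is \<in> set_pmf (batches n N B)"
    and \<omega>: "\<omega> \<in> set_pmf (step_given_batches sch gf h n N B \<eta> lam b xt x Is)"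
  defines "D \<equiv> L * norm (x - xt)"
  defines "ubar \<equiv> (1 / real N) *\<^sub>R (\<Sum>i<N. mb_u gf B xt x (Is i))"
  defines "Q \<equiv> real CARD('d) * lam\<^sup>2 / (2 ^ (b - 1) - 1)\<^sup>2"
  shows "P (fst \<omega>) + \<beta> * (norm (fst \<omega> - x))\<^sup>2 \<le> P x - \<alpha> * gnorm2 x
     + \<eta> / 2 * (3 * ((norm (ubar - (full_grad gf n x - full_grad gf n xt)))\<^sup>2
       + D\<^sup>2 * (Q + dlam * (1 - lam)\<^sup>2) + D\<^sup>2 * (if sch = SchemeC then Q else 0)))"
proof -
  define u where "u i = mb_u gf B xt x (Is i)" for i
  obtain q ut where q: "q \<in> set_pmf (Pi_pmf {..<N} 0 (\<lambda>i. qvec (used_scale sch lam b N u i) b (u i)))"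
    and ut: "ut \<in> set_pmf (aggregate sch lam b N u q)"
    and \<omega>_eq: "\<omega> = (prox \<eta> h (x - \<eta> *\<^sub>R (ut + full_grad gf n xt)),
        map (\<lambda>i. (u i, used_scale sch lam b N u i)) [0..<N])"
    using \<omega> unfolding step_given_batches_def u_def[symmetric] by (auto simp: Let_def)
  have uD: "norm (u i) \<le> D" if "i < N" for i
    unfolding u_def D_def using that by (intro mb_u_norm_le[OF B_pos batches_in_range[OF n_pos Is]] lip)
  have "\<omega> \<in> set_pmf (step xt x)" unfolding lpc_step_eq using Is \<omega> by auto
  then have out: "real (n_outside b (used_scale sch lam b N u i) (u i)) \<le> dlam" if "i < N" for i
    using ok that unfolding log_ok_def \<omega>_eq by force
  let ?avg = "(1 / real N) *\<^sub>R (\<Sum>i<N. q i)"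
  let ?T = "full_grad gf n x - full_grad gf n xt"
  have err: "(norm (?avg - ubar))\<^sup>2 \<le> D\<^sup>2 * (Q + dlam * (1 - lam)\<^sup>2)"
    "(norm (ut - ?avg))\<^sup>2 \<le> D\<^sup>2 * (if sch = SchemeC then Q else 0)"
    using aggregate_error[OF N_pos b_ge lam uD out q ut] unfolding Q_def ubar_def u_def by auto
  have "(norm (ut - ?T))\<^sup>2 = (norm ((ubar - ?T) + (?avg - ubar) + (ut - ?avg)))\<^sup>2" by (simp add: algebra_simps)
  also have "\<dots> \<le> 3 * ((norm (ubar - ?T))\<^sup>2 + (norm (?avg - ubar))\<^sup>2 + (norm (ut - ?avg))\<^sup>2)"
    by (rule norm_sum3_square_le)
  also have "\<dots> \<le> 3 * ((norm (ubar - ?T))\<^sup>2 + D\<^sup>2 * (Q + dlam * (1 - lam)\<^sup>2)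
      + D\<^sup>2 * (if sch = SchemeC then Q else 0))"
    by (intro mult_left_mono add_mono order_refl err) auto
  finally have e: "(norm (ut - ?T))\<^sup>2 \<le> 3 * ((norm (ubar - ?T))\<^sup>2
      + D\<^sup>2 * (Q + dlam * (1 - lam)\<^sup>2) + D\<^sup>2 * (if sch = SchemeC then Q else 0))" (is "_ \<le> ?W") .
  define W where "W = ?W"
  have w: "\<eta> / 2 * (norm (ut - ?T))\<^sup>2 \<le> \<eta> / 2 * W"
    unfolding W_def using eta_pos by (intro mult_left_mono e) auto
  have v: "ut + full_grad gf n xt - full_grad gf n x = ut - ?T" by simp
  have r: "\<eta> * L = \<rho>" using L_pos by simp
  have "P (fst \<omega>) + \<alpha> * gnorm2 x + \<beta> * (norm (fst \<omega> - x))\<^sup>2 \<le> P x + \<eta> / 2 * (norm (ut - ?T))\<^sup>2"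
    using inexact_prox_step[OF hx, of "ut + full_grad gf n xt"]
    unfolding v r \<omega>_eq fst_conv \<alpha>_def \<beta>_def .
  with w have "P (fst \<omega>) + \<beta> * (norm (fst \<omega> - x))\<^sup>2 \<le> P x - \<alpha> * gnorm2 x + \<eta> / 2 * W" by linarith
  then show ?thesis unfolding W_def .
qed

lemma step_expectation:
  assumes hx: "h x \<noteq> \<infinity>" and ok: "log_ok (step xt x)"
  shows "measure_pmf.expectation (step xt x) (\<lambda>\<omega>. P (fst \<omega>) + \<beta> * (norm (fst \<omega> - x))\<^sup>2)
     \<le> P x - \<alpha> * gnorm2 x + \<gamma> * (norm (x - xt))\<^sup>2"
proof -
  define D where "D = L * norm (x - xt)"
  define Q where "Q = real CARD('d) * lam\<^sup>2 / (2 ^ (b - 1) - 1)\<^sup>2"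
  define R where "R = D\<^sup>2 * (Q + dlam * (1 - lam)\<^sup>2) + D\<^sup>2 * (if sch = SchemeC then Q else 0)"
  define V where "V Is = (norm ((1 / real N) *\<^sub>R (\<Sum>i<N. mb_u gf B xt x (Is i))
      - (full_grad gf n x - full_grad gf n xt)))\<^sup>2" for Is
  note fin = finite_set_batches[OF n_pos, of N B]
  have EV: "measure_pmf.expectation (batches n N B) V \<le> D\<^sup>2 / (real N * real B)"
    unfolding V_def D_def by (intro minibatch_variance n_pos N_pos B_pos lip)
  have "measure_pmf.expectation (step xt x) (\<lambda>\<omega>. P (fst \<omega>) + \<beta> * (norm (fst \<omega> - x))\<^sup>2)
     \<le> measure_pmf.expectation (batches n N B) (\<lambda>Is. P x - \<alpha> * gnorm2 x + \<eta> / 2 * (3 * (V Is + R)))"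
    unfolding lpc_step_eq
    using step_bound[OF hx ok] fin finite_set_step_given_batches
    by (intro expectation_bind_le) (auto simp: V_def R_def D_def Q_def add.assoc)
  also have "\<dots> = P x - \<alpha> * gnorm2 x + \<eta> / 2 * (3 * (measure_pmf.expectation (batches n N B) V + R))"
    by (simp add: integrable_measure_pmf_finite[OF fin])
  also have "\<dots> \<le> P x - \<alpha> * gnorm2 x + \<eta> / 2 * (16 * D\<^sup>2 * noise)"
  proof -
    have Q0: "Q \<ge> 0" by (simp add: Q_def)
    have "3 * (measure_pmf.expectation (batches n N B) V + R) \<le> 3 * (D\<^sup>2 / (real N * real B) + R)"
      using EV by simp
    also have "\<dots> \<le> 16 * D\<^sup>2 * noise"
    proof -
      define e where "e = dlam * (1 - lam)\<^sup>2"
      define z where "z = 1 / (real N * real B)"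
      have nz: "noise = (if sch = SchemeC then 3 / 8 else 1 / 4) * Q + e + z"
        by (simp add: noise_def Q_def e_def z_def)
      have "0 \<le> D\<^sup>2 * Q" "0 \<le> D\<^sup>2 * e" "0 \<le> D\<^sup>2 * z"
        using Q0 dlam_nonneg by (auto simp: e_def z_def)
      \<comment> \<open>The factor 3 comes from the three-term split. Two roundings under
        \<open>SchemeC\<close> give 6 Q, exactly 16 * 3/8; one rounding gives 3 Q, below 16 * 1/4;
        the other terms need only 3 \<le> 16.\<close>
      then have "3 * (D\<^sup>2 * z + (D\<^sup>2 * (Q + e) + D\<^sup>2 * (if sch = SchemeC then Q else 0))) \<le> 16 * D\<^sup>2 * noise"
        unfolding nz by (cases "sch = SchemeC") (simp_all add: algebra_simps)
      then show ?thesis by (simp add: R_def e_def z_def)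
    qed
    finally show ?thesis using eta_pos by (intro add_left_mono mult_left_mono) auto
  qed
  also have "\<eta> / 2 * (16 * D\<^sup>2 * noise) = \<gamma> * (norm (x - xt))\<^sup>2"
    by (simp add: \<gamma>_def D_def power_mult_distrib)
  finally show ?thesis by simp
qed

section \<open>Unrolling the loops and the bound for one epoch\<close>

lemma inner_loop_Suc:
  "inner_loop xt (Suc k) x = bind_pmf (step xt x)
     (\<lambda>\<sigma>. map_pmf (\<lambda>\<omega>. (x # fst \<omega>, snd \<sigma> @ snd \<omega>)) (inner_loop xt k (fst \<sigma>)))"
  by (simp only: lpc_inner.simps case_prod_beta')

lemma outer_loop_Suc:
  "outer_loop (Suc s) xt = bind_pmf (inner_loop xt m xt)
     (\<lambda>\<sigma>. map_pmf (\<lambda>\<omega>. (take m (fst \<sigma>) @ fst \<omega>, snd \<sigma> @ snd \<omega>))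
           (outer_loop s (last (fst \<sigma>))))"
  by (simp only: lpc_outer.simps case_prod_beta')

lemma finite_set_inner: "finite (set_pmf (inner_loop xt k x))"
proof (induction k arbitrary: x)
  case (Suc k)
  then show ?case unfolding inner_loop_Suc set_bind_pmf set_map_pmf
    by (intro finite_UN_I finite_set_step finite_imageI)
qed simp

text \<open>The list also records the final point, the next snapshot, hence one entry more than
  there are steps. That point is a proximal point or the start, so \<open>h\<close> is finite
  there.\<close>

lemma inner_loop_shape:
  assumes "\<omega> \<in> set_pmf (inner_loop xt k x)" "h x \<noteq> \<infinity>"
  shows "length (fst \<omega>) = Suc k \<and> fst \<omega> ! 0 = x \<and> h (fst \<omega> ! k) \<noteq> \<infinity>"
  using assms
proof (induction k arbitrary: x \<omega>)
  case (Suc k)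
  then obtain \<sigma> \<omega>' where s: "\<sigma> \<in> set_pmf (step xt x)" and w: "\<omega>' \<in> set_pmf (inner_loop xt k (fst \<sigma>))"
    and e: "fst \<omega> = x # fst \<omega>'" unfolding inner_loop_Suc by auto
  from Suc.IH[OF w h_step[OF s]] show ?case by (simp add: e)
qed simp

text \<open>The log of a run is the log of its first step followed by that of the rest. Every first
  step has some continuation in the support, so a bound on complete logs passes to both
  pieces.\<close>

lemma log_ok_inner_Suc:
  assumes "log_ok (inner_loop xt (Suc k) x)"
  shows "log_ok (step xt x)" "\<sigma> \<in> set_pmf (step xt x) \<Longrightarrow> log_ok (inner_loop xt k (fst \<sigma>))"
proof -
  have key: "\<forall>(u, \<delta>)\<in>set (snd \<sigma> @ snd \<omega>). real (n_outside b \<delta> u) \<le> dlam"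
    if "\<sigma> \<in> set_pmf (step xt x)" "\<omega> \<in> set_pmf (inner_loop xt k (fst \<sigma>))" for \<sigma> \<omega>
  proof -
    have "(x # fst \<omega>, snd \<sigma> @ snd \<omega>) \<in> set_pmf (inner_loop xt (Suc k) x)"
      unfolding inner_loop_Suc set_bind_pmf set_map_pmf
      by (intro UN_I[OF that(1)] image_eqI[OF _ that(2)] refl)
    then show ?thesis using assms unfolding log_ok_def by fastforce
  qed
  show "log_ok (step xt x)" unfolding log_ok_def
  proof
    fix \<sigma> assume s: "\<sigma> \<in> set_pmf (step xt x)"
    obtain \<omega> where "\<omega> \<in> set_pmf (inner_loop xt k (fst \<sigma>))" using set_pmf_not_empty by fast
    from key[OF s this] show "\<forall>(u, \<delta>)\<in>set (snd \<sigma>). real (n_outside b \<delta> u) \<le> dlam" by auto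
  qed
  show "\<sigma> \<in> set_pmf (step xt x) \<Longrightarrow> log_ok (inner_loop xt k (fst \<sigma>))"
    unfolding log_ok_def using key by fastforce
qed

text \<open>The terms in \<open>\<beta>\<close> and \<open>\<gamma>\<close> are kept under the expectation: their sum is nonnegative only along a
  whole epoch, not step by step.\<close>

lemma inner_expectation:
  assumes "h x \<noteq> \<infinity>" "log_ok (inner_loop xt k x)"
  shows "measure_pmf.expectation (inner_loop xt k x) (\<lambda>\<omega>.
      (\<Sum>j<k. \<alpha> * gnorm2 (fst \<omega> ! j) + \<beta> * (norm (fst \<omega> ! Suc j - fst \<omega> ! j))\<^sup>2
          - \<gamma> * (norm (fst \<omega> ! j - xt))\<^sup>2) + P (fst \<omega> ! k)) \<le> P x"
  using assms
proof (induction k arbitrary: x)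
  case (Suc k)
  define c where "c y y' = \<alpha> * gnorm2 y + \<beta> * (norm (y' - y))\<^sup>2 - \<gamma> * (norm (y - xt))\<^sup>2" for y y'
  define cost where "cost l xs = (\<Sum>j<l. c (xs ! j) (xs ! Suc j)) + P (xs ! l)" for l xs
  note ok = log_ok_inner_Suc[OF Suc.prems(2)]
  have IH: "measure_pmf.expectation (inner_loop xt k (fst \<sigma>)) (\<lambda>\<omega>. cost k (fst \<omega>)) \<le> P (fst \<sigma>)"
    if "\<sigma> \<in> set_pmf (step xt x)" for \<sigma>
    using Suc.IH[OF h_step[OF that] ok(2)[OF that]] unfolding cost_def c_def by simp
  have "measure_pmf.expectation (inner_loop xt (Suc k) x) (\<lambda>\<omega>. cost (Suc k) (fst \<omega>))
      = measure_pmf.expectation (step xt x) (\<lambda>\<sigma>. measure_pmf.expectation (inner_loop xt k (fst \<sigma>))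
          (\<lambda>\<omega>. cost (Suc k) (x # fst \<omega>)))"
    unfolding inner_loop_Suc using finite_set_step finite_set_inner by (subst expectation_bind_finite) auto
  also have "\<dots> = measure_pmf.expectation (step xt x) (\<lambda>\<sigma>. c x (fst \<sigma>)
      + measure_pmf.expectation (inner_loop xt k (fst \<sigma>)) (\<lambda>\<omega>. cost k (fst \<omega>)))"
  proof (rule expectation_cong_pmf)
    fix \<sigma> assume s: "\<sigma> \<in> set_pmf (step xt x)"
    \<comment> \<open>The remaining list starts with \<open>fst \<sigma>\<close>, so the first
      summand is \<open>c x (fst \<sigma>)\<close> and shifting the index leaves the cost of the
      tail.\<close>
    have "measure_pmf.expectation (inner_loop xt k (fst \<sigma>)) (\<lambda>\<omega>. cost (Suc k) (x # fst \<omega>))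
      = measure_pmf.expectation (inner_loop xt k (fst \<sigma>)) (\<lambda>\<omega>. c x (fst \<sigma>) + cost k (fst \<omega>))"
      using inner_loop_shape[OF _ h_step[OF s]]
      by (intro expectation_cong_pmf) (auto simp: cost_def sum.lessThan_Suc_shift simp del: sum.lessThan_Suc)
    then show "measure_pmf.expectation (inner_loop xt k (fst \<sigma>)) (\<lambda>\<omega>. cost (Suc k) (x # fst \<omega>))
      = c x (fst \<sigma>) + measure_pmf.expectation (inner_loop xt k (fst \<sigma>)) (\<lambda>\<omega>. cost k (fst \<omega>))"
      by (simp add: integrable_measure_pmf_finite[OF finite_set_inner])
  qed
  also have "\<dots> \<le> measure_pmf.expectation (step xt x) (\<lambda>\<sigma>. \<alpha> * gnorm2 x - \<gamma> * (norm (x - xt))\<^sup>2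
      + (P (fst \<sigma>) + \<beta> * (norm (fst \<sigma> - x))\<^sup>2))"
    using IH by (intro expectation_mono_finite finite_set_step) (force simp: c_def)
  also have "\<dots> = \<alpha> * gnorm2 x - \<gamma> * (norm (x - xt))\<^sup>2
      + measure_pmf.expectation (step xt x) (\<lambda>\<sigma>. P (fst \<sigma>) + \<beta> * (norm (fst \<sigma> - x))\<^sup>2)"
    by (subst Bochner_Integration.integral_add)
      (simp_all add: integrable_measure_pmf_finite[OF finite_set_step])
  also have "\<dots> \<le> P x" using step_expectation[OF Suc.prems(1) ok(1)] by simp
  finally show ?case unfolding cost_def c_def .
qed simp

text \<open>An epoch starts at its snapshot, so displacements from \<open>xt\<close> are
  displacements from entry 0. Their sum weighted by \<open>\<gamma>\<close> is at most the sum of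
  squared steps weighted by \<open>\<beta>\<close>, and the surplus is dropped.\<close>

lemma epoch_expectation:
  assumes "h xt \<noteq> \<infinity>" "log_ok (inner_loop xt m xt)"
  shows "measure_pmf.expectation (inner_loop xt m xt)
      (\<lambda>\<omega>. (\<Sum>j<m. \<alpha> * gnorm2 (fst \<omega> ! j)) + P (fst \<omega> ! m)) \<le> P xt"
proof -
  have "measure_pmf.expectation (inner_loop xt m xt)
      (\<lambda>\<omega>. (\<Sum>j<m. \<alpha> * gnorm2 (fst \<omega> ! j)) + P (fst \<omega> ! m))
    \<le> measure_pmf.expectation (inner_loop xt m xt) (\<lambda>\<omega>.
      (\<Sum>j<m. \<alpha> * gnorm2 (fst \<omega> ! j) + \<beta> * (norm (fst \<omega> ! Suc j - fst \<omega> ! j))\<^sup>2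
          - \<gamma> * (norm (fst \<omega> ! j - xt))\<^sup>2) + P (fst \<omega> ! m))"
  proof (rule expectation_mono_finite[OF finite_set_inner])
    fix \<omega> assume w: "\<omega> \<in> set_pmf (inner_loop xt m xt)"
    let ?x = "\<lambda>j. fst \<omega> ! j"
    have x0: "?x 0 = xt" using inner_loop_shape[OF w assms(1)] by simp
    define A where "A = (\<Sum>j<m. (norm (?x (Suc j) - ?x j))\<^sup>2)"
    have A0: "A \<ge> 0" unfolding A_def by (intro sum_nonneg) auto
    have "\<gamma> * (\<Sum>j<m. (norm (?x j - xt))\<^sup>2) \<le> \<gamma> * ((real m)\<^sup>2 / 2 * A)"
      using sum_norm_displacement_le[of ?x m] \<gamma>_nonneg unfolding x0 A_def by (intro mult_left_mono)
    also have "\<dots> \<le> \<beta> * A" using mult_right_mono[OF \<gamma>_le_\<beta> A0] by (simp add: mult_ac)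
    finally show "(\<Sum>j<m. \<alpha> * gnorm2 (?x j)) + P (?x m) \<le>
      (\<Sum>j<m. \<alpha> * gnorm2 (?x j) + \<beta> * (norm (?x (Suc j) - ?x j))\<^sup>2 - \<gamma> * (norm (?x j - xt))\<^sup>2) + P (?x m)"
      by (simp add: sum.distrib sum_subtractf sum_distrib_left A_def)
  qed
  also have "\<dots> \<le> P xt" by (rule inner_expectation[OF assms])
  finally show ?thesis .
qed

section \<open>The outer loop and the randomly chosen output\<close>

lemma finite_set_outer: "finite (set_pmf (outer_loop s xt))"
proof (induction s arbitrary: xt)
  case (Suc s)
  then show ?case unfolding outer_loop_Suc set_bind_pmf set_map_pmf
    by (intro finite_UN_I finite_set_inner finite_imageI)
qed simp

text \<open>Of the m + 1 points of an epoch the last is cut off, since it is the starting point of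
  the next epoch.\<close>

lemma outer_loop_length:
  assumes "\<omega> \<in> set_pmf (outer_loop s xt)" "h xt \<noteq> \<infinity>"
  shows "length (fst \<omega>) = s * m"
  using assms
proof (induction s arbitrary: xt \<omega>)
  case (Suc s)
  then obtain \<sigma> \<omega>' where s: "\<sigma> \<in> set_pmf (inner_loop xt m xt)"
    and w: "\<omega>' \<in> set_pmf (outer_loop s (last (fst \<sigma>)))"
    and e: "fst \<omega> = take m (fst \<sigma>) @ fst \<omega>'" unfolding outer_loop_Suc by auto
  have sh: "length (fst \<sigma>) = Suc m" "h (fst \<sigma> ! m) \<noteq> \<infinity>" using inner_loop_shape[OF s Suc.prems(2)] by auto
  then have "h (last (fst \<sigma>)) \<noteq> \<infinity>" by (subst last_conv_nth) auto
  from Suc.IH[OF w this] sh show ?case by (simp add: e)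
qed simp

lemma log_ok_outer_Suc:
  assumes "log_ok (outer_loop (Suc s) xt)"
  shows "log_ok (inner_loop xt m xt)"
    "\<sigma> \<in> set_pmf (inner_loop xt m xt) \<Longrightarrow> log_ok (outer_loop s (last (fst \<sigma>)))"
proof -
  have key: "\<forall>(u, \<delta>)\<in>set (snd \<sigma> @ snd \<omega>). real (n_outside b \<delta> u) \<le> dlam"
    if "\<sigma> \<in> set_pmf (inner_loop xt m xt)" "\<omega> \<in> set_pmf (outer_loop s (last (fst \<sigma>)))" for \<sigma> \<omega>
  proof -
    have "(take m (fst \<sigma>) @ fst \<omega>, snd \<sigma> @ snd \<omega>) \<in> set_pmf (outer_loop (Suc s) xt)"
      unfolding outer_loop_Suc set_bind_pmf set_map_pmf
      by (intro UN_I[OF that(1)] image_eqI[OF _ that(2)] refl)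
    then show ?thesis using assms unfolding log_ok_def by fastforce
  qed
  show "log_ok (inner_loop xt m xt)" unfolding log_ok_def
  proof
    fix \<sigma> assume s: "\<sigma> \<in> set_pmf (inner_loop xt m xt)"
    obtain \<omega> where "\<omega> \<in> set_pmf (outer_loop s (last (fst \<sigma>)))" using set_pmf_not_empty by fast
    from key[OF s this] show "\<forall>(u, \<delta>)\<in>set (snd \<sigma>). real (n_outside b \<delta> u) \<le> dlam" by auto
  qed
  show "\<sigma> \<in> set_pmf (inner_loop xt m xt) \<Longrightarrow> log_ok (outer_loop s (last (fst \<sigma>)))"
    unfolding log_ok_def using key by fastforce
qed

text \<open>The epoch bounds telescope in the objective at the snapshots, and minimality of
  \<open>xstar\<close> ends the chain. The snapshot is arbitrary in the induction because the next
  one is random.\<close>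

lemma outer_expectation:
  assumes "h xt \<noteq> \<infinity>" "log_ok (outer_loop s xt)"
  shows "measure_pmf.expectation (outer_loop s xt) (\<lambda>\<omega>. \<Sum>x\<leftarrow>fst \<omega>. \<alpha> * gnorm2 x) \<le> P xt - P xstar"
  using assms
proof (induction s arbitrary: xt)
  case 0
  then show ?case using P_ge by simp
next
  case (Suc s)
  note ok = log_ok_outer_Suc[OF Suc.prems(2)]
  define T where "T xs = (\<Sum>x\<leftarrow>xs. \<alpha> * gnorm2 x)" for xs
  have "measure_pmf.expectation (outer_loop (Suc s) xt) (\<lambda>\<omega>. T (fst \<omega>))
      = measure_pmf.expectation (inner_loop xt m xt) (\<lambda>\<sigma>. T (take m (fst \<sigma>))
          + measure_pmf.expectation (outer_loop s (last (fst \<sigma>))) (\<lambda>\<omega>. T (fst \<omega>)))"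
    unfolding outer_loop_Suc using finite_set_inner finite_set_outer
    by (subst expectation_bind_finite) (auto simp: T_def integrable_measure_pmf_finite[OF finite_set_outer])
  also have "\<dots> \<le> measure_pmf.expectation (inner_loop xt m xt)
      (\<lambda>\<sigma>. ((\<Sum>j<m. \<alpha> * gnorm2 (fst \<sigma> ! j)) + P (fst \<sigma> ! m)) - P xstar)"
  proof (rule expectation_mono_finite[OF finite_set_inner])
    fix \<sigma> assume s: "\<sigma> \<in> set_pmf (inner_loop xt m xt)"
    have sh: "length (fst \<sigma>) = Suc m" "h (fst \<sigma> ! m) \<noteq> \<infinity>" using inner_loop_shape[OF s Suc.prems(1)] by auto
    have l: "last (fst \<sigma>) = fst \<sigma> ! m" using sh by (subst last_conv_nth) auto
    have "T (take m (fst \<sigma>)) = (\<Sum>j<m. \<alpha> * gnorm2 (fst \<sigma> ! j))"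
      using sh unfolding T_def by (subst sum_list_sum_nth) (auto simp: atLeast0LessThan intro!: sum.cong)
    moreover have "measure_pmf.expectation (outer_loop s (last (fst \<sigma>))) (\<lambda>\<omega>. T (fst \<omega>)) \<le> P (fst \<sigma> ! m) - P xstar"
      using Suc.IH[of "last (fst \<sigma>)"] ok(2)[OF s] sh unfolding l T_def by simp
    ultimately show "T (take m (fst \<sigma>)) + measure_pmf.expectation (outer_loop s (last (fst \<sigma>))) (\<lambda>\<omega>. T (fst \<omega>))
      \<le> ((\<Sum>j<m. \<alpha> * gnorm2 (fst \<sigma> ! j)) + P (fst \<sigma> ! m)) - P xstar" by simp
  qed
  also have "\<dots> = measure_pmf.expectation (inner_loop xt m xt)
      (\<lambda>\<sigma>. (\<Sum>j<m. \<alpha> * gnorm2 (fst \<sigma> ! j)) + P (fst \<sigma> ! m)) - P xstar"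
    by (subst Bochner_Integration.integral_diff)
      (simp_all add: integrable_measure_pmf_finite[OF finite_set_inner])
  also have "\<dots> \<le> P xt - P xstar" using epoch_expectation[OF Suc.prems(1) ok(1)] by simp
  finally show ?case unfolding T_def .
qed

text \<open>All lists in the support have length S m, so the uniform choice of an entry is an
  average with a fixed denominator; the factor \<open>\<alpha>\<close> is inserted and divided out
  to match the telescoped bound.\<close>

lemma output_expectation:
  assumes S: "S > 0" and hx: "h x0 \<noteq> \<infinity>" and ok: "log_ok (outer_loop S x0)"
  shows "measure_pmf.expectation (lpc_output sch gf h n N B \<eta> lam b m S x0) gnorm2
    \<le> 2 * L / (\<rho> * (1 - 2 * \<rho>) * real (S * m)) * (P x0 - P xstar)"
proof -
  have Sm: "S * m > 0" using S m_pos by simp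
  have eq: "lpc_output sch gf h n N B \<eta> lam b m S x0 = bind_pmf (outer_loop S x0)
      (\<lambda>\<omega>. map_pmf (\<lambda>j. fst \<omega> ! j) (pmf_of_set {..<length (fst \<omega>)}))"
    unfolding lpc_output_def by (intro bind_pmf_cong refl) (simp add: split_beta)
  have "measure_pmf.expectation (lpc_output sch gf h n N B \<eta> lam b m S x0) gnorm2
    = measure_pmf.expectation (outer_loop S x0)
        (\<lambda>\<omega>. measure_pmf.expectation (pmf_of_set {..<length (fst \<omega>)}) (\<lambda>j. gnorm2 (fst \<omega> ! j)))"
    unfolding eq using outer_loop_length[OF _ hx] Sm
    by (subst expectation_bind_finite) (auto simp: finite_set_outer lessThan_empty_iff)
  also have "\<dots> = measure_pmf.expectation (outer_loop S x0)
      (\<lambda>\<omega>. 1 / (\<alpha> * real (S * m)) * (\<Sum>x\<leftarrow>fst \<omega>. \<alpha> * gnorm2 x))"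
  proof (rule expectation_cong_pmf)
    fix \<omega> assume "\<omega> \<in> set_pmf (outer_loop S x0)"
    then have l: "length (fst \<omega>) = S * m" using outer_loop_length hx by blast
    have "(\<Sum>x\<leftarrow>fst \<omega>. \<alpha> * gnorm2 x) = \<alpha> * (\<Sum>j<S * m. gnorm2 (fst \<omega> ! j))"
      using l by (subst sum_list_sum_nth) (auto simp: atLeast0LessThan sum_distrib_left)
    moreover have "measure_pmf.expectation (pmf_of_set {..<length (fst \<omega>)}) (\<lambda>j. gnorm2 (fst \<omega> ! j))
        = (\<Sum>j<S * m. gnorm2 (fst \<omega> ! j)) / real (S * m)"
      unfolding l using Sm by (subst integral_pmf_of_set) (auto simp: lessThan_empty_iff)
    ultimately show "measure_pmf.expectation (pmf_of_set {..<length (fst \<omega>)}) (\<lambda>j. gnorm2 (fst \<omega> ! j))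
        = 1 / (\<alpha> * real (S * m)) * (\<Sum>x\<leftarrow>fst \<omega>. \<alpha> * gnorm2 x)"
      using \<alpha>_pos by simp
  qed
  also have "\<dots> = 1 / (\<alpha> * real (S * m)) * measure_pmf.expectation (outer_loop S x0) (\<lambda>\<omega>. \<Sum>x\<leftarrow>fst \<omega>. \<alpha> * gnorm2 x)"
    by simp
  also have "\<dots> \<le> 1 / (\<alpha> * real (S * m)) * (P x0 - P xstar)"
    using outer_expectation[OF hx ok] \<alpha>_pos by (intro mult_left_mono) auto
  also have "1 / (\<alpha> * real (S * m)) = 2 * L / (\<rho> * (1 - 2 * \<rho>) * real (S * m))"
    by (simp add: \<alpha>_def)
  finally show ?thesis .
qed

end

theorem theorem2:
  fixes fs :: "nat \<Rightarrow> real^'d \<Rightarrow> real"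
    and gf :: "nat \<Rightarrow> real^'d \<Rightarrow> real^'d"
    and h :: "real^'d \<Rightarrow> ereal"
    and n N S m B b :: nat
    and L \<rho> lam dlam :: real
    and sch :: scheme
    and x0 xstar :: "real^'d"
  assumes n_pos: "n > 0" and N_pos: "N > 0" and S_pos: "S > 0" and m_pos: "m > 0" and B_pos: "B > 0"
    and grad: "\<And>i x. i \<in> {1..n} \<Longrightarrow> (fs i has_derivative (\<lambda>v. gf i x \<bullet> v)) (at x)"
    and L_pos: "L > 0"
    and lip: "\<And>i x y. i \<in> {1..n} \<Longrightarrow> norm (gf i x - gf i y) \<le> L * norm (x - y)"
    and h_proper: "proper_fun h" and h_convex: "convex_ext h" and h_lsc: "lsc_fun h"
    and xstar_min: "\<And>x. ereal ((1 / real n) * (\<Sum>i=1..n. fs i xstar)) + h xstar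
                        \<le> ereal ((1 / real n) * (\<Sum>i=1..n. fs i x)) + h x"
    and b_ge: "b \<ge> 2"
    and lam: "0 < lam" "lam \<le> 1"
    and rho: "0 < \<rho>" "\<rho> < 1 / 2"
    and d_lam_nonneg: "dlam \<ge> 0"
    and d_lam: "AE \<omega> in measure_pmf (lpc_outer sch gf h n N B (\<rho> / L) lam b m S x0).
                  \<forall>(u, \<delta>) \<in> set (snd \<omega>). real (n_outside b \<delta> u) \<le> dlam"
    and cond: "((sch = SchemeA \<or> sch = SchemeB) \<and>
                 8 * real m ^ 2 * \<rho> ^ 2 * (real CARD('d) * lam ^ 2 / (4 * (2 ^ (b - 1) - 1) ^ 2)
                     + dlam * (1 - lam) ^ 2 + 1 / (real N * real B)) + \<rho> \<le> 1)
             \<or> (sch = SchemeC \<and>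
                 8 * real m ^ 2 * \<rho> ^ 2 * (3 * real CARD('d) * lam ^ 2 / (8 * (2 ^ (b - 1) - 1) ^ 2)
                     + dlam * (1 - lam) ^ 2 + 1 / (real N * real B)) + \<rho> \<le> 1)"
  shows "ereal (measure_pmf.expectation (lpc_output sch gf h n N B (\<rho> / L) lam b m S x0)
                 (\<lambda>x. (norm (grad_map (\<rho> / L) h (full_grad gf n) x))\<^sup>2))
         \<le> ereal (2 * L / (\<rho> * (1 - 2 * \<rho>) * real (S * m)))
            * ((ereal ((1 / real n) * (\<Sum>i=1..n. fs i x0)) + h x0)
               - (ereal ((1 / real n) * (\<Sum>i=1..n. fs i xstar)) + h xstar))"
proof -
  interpret lpc_svrg fs gf h n N m B b L \<rho> lam dlam sch xstar
  proof (unfold_locales, unfold mean_fun_def; fact?)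
    show "8 * (real m)\<^sup>2 * \<rho>\<^sup>2 * ((if sch = SchemeC then 3 / 8 else 1 / 4)
        * (real CARD('d) * lam\<^sup>2 / (2 ^ (b - 1) - 1)\<^sup>2)
        + dlam * (1 - lam)\<^sup>2 + 1 / (real N * real B)) + \<rho> \<le> 1"
      using cond by (auto simp: mult.assoc)
  qed
  have xs: "h xstar = ereal (hr xstar)" by (intro ereal_hr h_xstar)
  show ?thesis
  proof (cases "h x0 = \<infinity>")
    case True
    \<comment> \<open>At a starting point with infinite \<open>h\<close> the right-hand side is
      infinite: its factor is positive and the optimal value is finite.\<close>
    then show ?thesis using L_pos rho S_pos m_pos by (simp add: xs)
  next
    case False
    \<comment> \<open>For a discrete distribution, almost surely means at every point of the
      support.\<close>
    have "log_ok (outer_loop S x0)"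
      using d_lam by (simp add: log_ok_def AE_measure_pmf_iff)
    from output_expectation[OF S_pos False this] show ?thesis
      by (simp add: xs ereal_hr[OF False] P_def mean_fun_def)
  qed
qed

end
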